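(* Let $\mathcal{F}_6$ be the class of functions $f\in\mathcal{A}$ such that $\left|f'(z)/g'(z)-1\right|<1$ for all $z\in\mathbb{D}$, for some univalent function $g\in\mathcal{A}$. Then the following sharp radius results hold (i.e. each radius below is exactly equal to the stated value): (a) for every $0\le\alpha<1$, the $\mathcal{C}(\alpha)$-radius of $\mathcal{F}_6$ is $R_{\mathcal{C}(\alpha)}(\mathcal{F}_6)=\dfrac{2(1-\alpha)}{5+\sqrt{25+4\alpha(\alpha-1)}}$; (b) the $\mathcal{UCV}$-radius of $\mathcal{F}_6$ is $R_{\mathcal{UCV}}(\mathcal{F}_6)=R_{\mathcal{C}(1/2)}(\mathcal{F}_6)=5-2\sqrt6$.
   Context: $\mathbb{D}=\{z\in\mathbb{C}:|z|<1\}$. $\mathcal{A}$ is the class of analytic functions $f$ on $\mathbb{D}$ with $f(0)=0$ and $f'(0)=1$; $\mathcal{S}\subset\mathcal{A}$ is the subclass of univalent (injective) functions. For $0\le\alpha<1$, $\mathcal{C}(\alpha)$ is the class of $f\in\mathcal{S}$ with $\operatorname{Re}(1+zf''(z)/f'(z))>\alpha$ on $\mathbb{D}$ (convex of order $\alpha$). $\mathcal{UCV}$ is the class of uniformly convex functions: $f\in\mathcal{S}$ such that for every circular arc $\gamma\subset\mathbb{D}$ with center $\zeta\in\mathbb{D}$ the image arc $f(\gamma)$ is convex; by a known theorem of Rønning and of Ma and Minda, $f\in\mathcal{UCV}$ if and only if $\operatorname{Re}\left(1+zf''(z)/f'(z)\right)>\left|zf''(z)/f'(z)\right|$ for all $z\in\mathbb{D}$.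 For families $\mathcal{G},\mathcal{F}\subset\mathcal{A}$, the $\mathcal{G}$-radius of $\mathcal{F}$, denoted $R_{\mathcal{G}}(\mathcal{F})$, is the largest number $R$ such that the function $z\mapsto r^{-1}f(rz)$ belongs to $\mathcal{G}$ for all $0<r\le R$ and all $f\in\mathcal{F}$. *)

theory Defs
  imports "HOL-Complex_Analysis.Complex_Analysis"
begin

text \<open>
  Functions on the unit disc \<open>\<bbbD>\<close> are total functions on \<^typ>\<open>complex\<close>; the classes below
  constrain them on \<open>ball 0 1\<close> only.
\<close>

definition class_A :: "(complex \<Rightarrow> complex) set" where
  "class_A = {f. f holomorphic_on ball 0 1 \<and> f 0 = 0 \<and> deriv f 0 = 1}"

definition class_S :: "(complex \<Rightarrow> complex) set" where
  "class_S = {f \<in> class_A. inj_on f (ball 0 1)}"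

definition class_C :: "real \<Rightarrow> (complex \<Rightarrow> complex) set" where
  "class_C \<alpha> = {f \<in> class_S. \<forall>z\<in>ball 0 1. Re (1 + z * deriv (deriv f) z / deriv f z) > \<alpha>}"

text \<open>
  Goodman's notion of a convex arc: the argument of the tangent vector is a nondecreasing
  function of the parameter. The argument \<open>\<theta>\<close> is a continuous branch along the arc,
  not the principal value.
\<close>

definition convex_arc :: "(real \<Rightarrow> complex) \<Rightarrow> real \<Rightarrow> real \<Rightarrow> bool" where
  "convex_arc c a b \<longleftrightarrow>
     (\<exists>\<theta>. continuous_on {a..b} \<theta> \<and> mono_on {a..b} \<theta> \<and>
       (\<forall>t\<in>{a..b}. \<exists>v. (c has_vector_derivative v) (at t within {a..b}) \<and> v \<noteq> 0 \<and>
          v = of_real (norm v) * cis (\<theta> t)))"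

text \<open>
  Circular arcs are traversed counterclockwise, and full circles (\<open>b = a + 2 * pi\<close>) are included.
\<close>

definition class_UCV :: "(complex \<Rightarrow> complex) set" where
  "class_UCV = {f \<in> class_S. \<forall>\<zeta>\<in>ball 0 1. \<forall>\<rho> a b.
      0 < \<rho> \<and> a < b \<and> b \<le> a + 2 * pi \<and>
      (\<lambda>t. \<zeta> + of_real \<rho> * cis t) ` {a..b} \<subseteq> ball 0 1 \<longrightarrow>
      convex_arc (\<lambda>t. f (\<zeta> + of_real \<rho> * cis t)) a b}"

definition class_F6 :: "(complex \<Rightarrow> complex) set" where
  "class_F6 = {f \<in> class_A. \<exists>g\<in>class_S. \<forall>z\<in>ball 0 1. norm (deriv f z / deriv g z - 1) < 1}"

text \<open>
  \<open>is_radius G F R\<close> says that \<open>R\<close> is the \<open>G\<close>-radius of \<open>F\<close>, i.e. the largest (attained) number with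
  the defining property. Only \<open>R \<le> 1\<close> are candidates, since \<open>f (r z)\<close> is meaningful for all
  \<open>z\<close> in the unit disc only if \<open>r \<le> 1\<close>. The radius is \<open>0\<close> if no positive number has the property.
\<close>

definition radius_property ::
  "(complex \<Rightarrow> complex) set \<Rightarrow> (complex \<Rightarrow> complex) set \<Rightarrow> real \<Rightarrow> bool" where
  "radius_property G F R \<longleftrightarrow> 0 \<le> R \<and> R \<le> 1 \<and>
     (\<forall>r f. 0 < r \<and> r \<le> R \<and> f \<in> F \<longrightarrow> (\<lambda>z. f (of_real r * z) / of_real r) \<in> G)"

definition is_radius ::
  "(complex \<Rightarrow> complex) set \<Rightarrow> (complex \<Rightarrow> complex) set \<Rightarrow> real \<Rightarrow> bool" where
  "is_radius G F R \<longleftrightarrow> radius_property G F R \<and> (\<forall>R'. radius_property G F R' \<longrightarrow> R' \<le> R)"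

end

theory Submission
  imports Defs
begin

text \<open>
  Let \<open>f\<close> be in the class, with \<open>g\<close> univalent and \<open>f' = g' (1 + w)\<close>. Since \<open>w 0 = 0\<close> and \<open>\<bar>w\<bar> < 1\<close>,
  the function \<open>w\<close> is a Schwarz function, and

    \<open>z f''/f' = z g''/g' + z w'/(1 + w)\<close>.

  Put \<open>u = \<bar>z\<bar>\<close>. Bieberbach's inequality \<open>\<bar>g''(0)\<bar> \<le> 4\<close>, applied to the Koebe transform of \<open>g\<close> at \<open>z\<close>,
  places the first summand in the disc with centre \<open>2 u\<^sup>2 / (1 - u\<^sup>2)\<close> and radius \<open>4 u / (1 - u\<^sup>2)\<close>;
  the Schwarz-Pick lemma bounds the second summand by \<open>u (1 + u) / (1 - u\<^sup>2)\<close>. Hence \<open>z f''/f'\<close> lies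
  in the disc with the same centre and radius \<open>(5 u + u\<^sup>2) / (1 - u\<^sup>2)\<close>
  (\<open>class_F6_convexity_disc\<close>). The leftmost point of this disc gives
  \<open>Re (1 + z f''/f') \<ge> (1 - 5 u) / (1 - u\<^sup>2)\<close>. The right-hand side exceeds \<open>\<alpha>\<close> exactly for \<open>u\<close> below
  the radius claimed for \<open>class_C \<alpha>\<close> (\<open>convexity_radius_quadratic\<close>). Equality holds at \<open>z = - u\<close>
  when \<open>g\<close> is the Koebe function and \<open>w z = z\<close>, so the radius is sharp. The classes also demand
  univalence of the dilated functions; all the radii are at most \<open>1/5\<close>, and on the disc of radius
  \<open>1/5\<close> the argument of \<open>f'\<close> stays below \<open>\<pi>/2\<close> (\<open>class_F6_inj_on\<close>).

  For uniform convexity, the tangent of the image of an arc about \<open>\<zeta>\<close> turns at the rate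
  \<open>Re (1 + (z - \<zeta>) F''/F')\<close>, so that \<open>F\<close> is uniformly convex if and only if this is nonnegative for
  all \<open>\<zeta>\<close> and \<open>z\<close> in the disc (\<open>class_UCV_iff\<close>). This follows from \<open>\<bar>z F''/F'\<bar> \<le> Re (1 + z F''/F')\<close>
  by the maximum principle. The disc above lies inside the parabola described by that inequality as
  long as its leftmost point satisfies \<open>Re (1 + z F''/F') \<ge> 1/2\<close>, which is the condition for
  \<open>class_C (1/2)\<close>. Conversely, the choice \<open>\<zeta> = - z\<close> for the extremal function shows that uniform
  convexity fails as soon as convexity of order \<open>1/2\<close> fails.

  Bieberbach's inequality is derived from Gronwall's area theorem. For an injective map of the form
  \<open>H z = 1/z + b z + O(z\<^sup>2)\<close> on the punctured disc, the image of the annulus \<open>\<epsilon> < \<bar>z\<bar> < \<rho>\<close> has area at least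
  \<open>\<pi> (1/\<epsilon>\<^sup>2 - 1/\<rho>\<^sup>2 + b\<^sup>2 (\<rho>\<^sup>2 - \<epsilon>\<^sup>2))\<close>, by the change of variables formula and orthogonality on
  circles. On the other hand it is enclosed by the nearly elliptic curve \<open>H (\<bar>z\<bar> = \<epsilon>)\<close>, whose interior
  has area at most \<open>\<pi>/\<epsilon>\<^sup>2 + O(\<epsilon>)\<close>. Letting \<open>\<epsilon>\<close> tend to \<open>0\<close> and \<open>\<rho>\<close> to \<open>1\<close> leaves \<open>\<bar>b\<bar> \<le> 1\<close>
  (\<open>area_theorem\<close>).
\<close>


section \<open>Area of conformal images\<close>

text \<open>Area is computed in \<^typ>\<open>real^2\<close>, so that changes of variables are governed by Jacobian determinants.\<close>

unbundle no fps_syntax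

definition plane :: "complex \<Rightarrow> real^2" where
  "plane z = vector [Re z, Im z]"

definition unplane :: "real^2 \<Rightarrow> complex" where
  "unplane x = Complex (x $ 1) (x $ 2)"

lemma plane_nth [simp]: "plane z $ 1 = Re z" "plane z $ 2 = Im z"
  by (simp_all add: plane_def)

lemma unplane_plane [simp]: "unplane (plane z) = z"
  by (simp add: unplane_def)

lemma plane_unplane [simp]: "plane (unplane x) = x"
  by (simp add: unplane_def vec_eq_iff forall_2)

lemma inj_plane: "inj plane"
  by (metis injI unplane_plane)

lemma linear_plane: "linear plane"
  by (rule linearI) (simp_all add: vec_eq_iff forall_2)

lemma linear_unplane: "linear unplane"
  by (rule linearI) (simp_all add: complex_eq_iff unplane_def)

lemma plane_image: "plane ` S = {x. unplane x \<in> S}"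
  by (auto simp: image_iff) (metis plane_unplane)

lemma plane_box: "plane ` box (Complex a c) (Complex b d) = box (vector [a, c]) (vector [b, d])"
  by (auto simp: plane_image mem_box_cart forall_2 in_box_complex_iff unplane_def)

lemma det_plane_mult: "det (matrix (\<lambda>x. plane (w * unplane x))) = (norm w)\<^sup>2"
  by (simp add: det_2 matrix_def axis_def unplane_def cmod_power2) (simp add: power2_eq_square)

text \<open>
  Fubini's theorem on \<^typ>\<open>real \<times> real\<close>, carried over to \<^typ>\<open>real^2\<close> by the obvious bijection, which maps
  boxes to boxes of the same content.
\<close>
lemma has_integral_plane_box:
  fixes f :: "complex \<Rightarrow> real"
  assumes cont: "continuous_on (cbox (Complex a c) (Complex b d)) f"
  shows "((\<lambda>x. f (unplane x)) has_integral integral {a..b} (\<lambda>s. integral {c..d} (\<lambda>t. f (Complex s t))))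
           (cbox (vector [a, c]) (vector [b, d]))"
proof -
  define F where "F = (\<lambda>p. f (Complex (fst p) (snd p)))"
  define g where "g = (\<lambda>x::real^2. (x $ 1, x $ 2))"
  define h where "h = (\<lambda>p::real\<times>real. vector [fst p, snd p] :: real^2)"
  have contF: "continuous_on (cbox (a, c) (b, d)) F"
    unfolding F_def
    by (rule continuous_on_compose2[OF cont]) 
       (auto simp: Complex_eq in_cbox_complex_iff mem_box intro!: continuous_intros)
  have "integral (cbox (a, c) (b, d)) F = integral {a..b} (\<lambda>s. integral {c..d} (\<lambda>t. f (Complex s t)))"
    using integral_prod_continuous[OF contF] by (simp add: F_def)
  then have I: "(F has_integral integral {a..b} (\<lambda>s. integral {c..d} (\<lambda>t. f (Complex s t)))) (cbox (a, c) (b, d))"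
    using integrable_continuous[OF contF] by (metis integrable_integral)
  have hg: "h (g x) = x" and gh: "g (h p) = p" for x p
    by (auto simp: h_def g_def vec_eq_iff forall_2)
  have hbox: "h ` cbox u v = cbox (h u) (h v)" for u v
  proof -
    have "h p \<in> cbox (h u) (h v) \<longleftrightarrow> p \<in> cbox u v" for p
      by (cases p; cases u; cases v) (auto simp: h_def mem_box_cart forall_2)
    then have "h ` cbox u v \<subseteq> cbox (h u) (h v)" "\<And>y. y \<in> cbox (h u) (h v) \<Longrightarrow> g y \<in> cbox u v"
      using hg by (blast, metis)
    then show ?thesis
      using hg by (metis image_iff subsetI subset_antisym)
  qed
  have gbox: "g ` cbox u v = cbox (g u) (g v)" for u v
  proof -
    have "g ` cbox u v = g ` h ` cbox (g u) (g v)"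
      using hbox[of "g u" "g v"] by (simp only: hg)
    also have "\<dots> = cbox (g u) (g v)"
      by (simp add: image_image gh)
    finally show ?thesis .
  qed
  have cont_g: "continuous (at x) g" for x
    unfolding g_def by (intro continuous_intros)
  have content_eq: "measure lborel (g ` cbox u v) = 1 * measure lborel (cbox u v)" for u v :: "real^2"
  proof (cases "cbox u v = {}")
    case False
    then have "u $ 1 \<le> v $ 1" "u $ 2 \<le> v $ 2"
      by (auto simp: interval_eq_empty_cart not_less)
    with False show ?thesis
      unfolding gbox by (simp add: g_def content_Pair content_cbox_cart UNIV_2)
  qed simp
  have "((\<lambda>x. F (g x)) has_integral (1/1) *\<^sub>R integral {a..b} (\<lambda>s. integral {c..d} (\<lambda>t. f (Complex s t)))) (h ` cbox (a, c) (b, d))"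
  proof (rule has_integral_twiddle[OF _ hg gh cont_g _ _ content_eq I])
    show "\<exists>w z. g ` cbox u v = cbox w z" for u v
      using gbox by blast
    show "\<exists>w z. h ` cbox u v = cbox w z" for u v
      using hbox by blast
  qed simp
  then show ?thesis
    unfolding hbox by (simp add: F_def g_def h_def unplane_def)
qed

text \<open>
  The real Jacobian of multiplication by \<open>w\<close> is \<open>\<bar>w\<bar>\<^sup>2\<close>. Injectivity is demanded on the open box only, so
  that the lemma applies to a box whose opposite sides are identified by \<open>f\<close>.
\<close>
lemma area_conformal_image:
  assumes holf: "f holomorphic_on U" and U: "open U"
    and sub: "cbox (Complex a c) (Complex b d) \<subseteq> U"
    and inj: "inj_on f (box (Complex a c) (Complex b d))"
  shows "plane ` f ` box (Complex a c) (Complex b d) \<in> lmeasurable" (is ?T)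
    and "measure lebesgue (plane ` f ` box (Complex a c) (Complex b d)) =
           integral {a..b} (\<lambda>s. integral {c..d} (\<lambda>t. (norm (deriv f (Complex s t)))\<^sup>2))" (is ?R)
proof -
  define B where "B = box (vector [a, c] :: real^2) (vector [b, d])"
  define \<Psi> where "\<Psi> = (\<lambda>x. plane (f (unplane x)))"
  define D where "D = (\<lambda>x. \<lambda>y. plane (deriv f (unplane x) * unplane y))"
  have B: "B = plane ` box (Complex a c) (Complex b d)"
    by (simp add: B_def plane_box)
  have inU: "unplane x \<in> U" if "x \<in> B" for x
    using that sub box_subset_cbox[of "Complex a c" "Complex b d"] unfolding B by force
  have der: "(\<Psi> has_derivative D x) (at x within B)" if "x \<in> B" for x
  proof -
    have 1: "(f has_derivative (*) (deriv f (unplane x))) (at (unplane x))"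
      using holomorphic_derivI[OF holf U inU[OF that]] by (simp add: has_field_derivative_def)
    have 2: "(unplane has_derivative unplane) (at x)" "(plane has_derivative plane) (at w)" for w
      using linear_unplane linear_plane by (auto intro: linear_imp_has_derivative)
    have "(\<Psi> has_derivative D x) (at x)"
      unfolding \<Psi>_def D_def
      by (rule has_derivative_compose[OF has_derivative_compose[OF 2(1) 1] 2(2)])
    then show ?thesis by (rule has_derivative_at_withinI)
  qed
  have injB: "inj_on \<Psi> B"
    using inj unfolding \<Psi>_def B inj_on_def by (auto dest: injD[OF inj_plane])
  have cont: "continuous_on (cbox (Complex a c) (Complex b d)) (\<lambda>z. (norm (deriv f z))\<^sup>2)"
    by (intro continuous_intros holomorphic_on_imp_continuous_on
          holomorphic_on_subset[OF holomorphic_deriv[OF holf U] sub])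
  have det: "\<bar>det (matrix (D x))\<bar> = (norm (deriv f (unplane x)))\<^sup>2" for x
    by (simp add: D_def det_plane_mult)
  have int: "((\<lambda>x. \<bar>det (matrix (D x))\<bar>) has_integral integral {a..b} (\<lambda>s. integral {c..d} (\<lambda>t. (norm (deriv f (Complex s t)))\<^sup>2))) B"
    unfolding det B_def using has_integral_plane_box[OF cont] by (rule has_integral_open_interval[THEN iffD2])
  have im: "\<Psi> ` B = plane ` f ` box (Complex a c) (Complex b d)"
    by (auto simp: B \<Psi>_def image_image)
  have leb: "B \<in> sets lebesgue" by (simp add: B_def)
  show ?R
    using measure_differentiable_image_eq[OF leb der injB] int im
    by (metis has_integral_integrable_integral)
  show ?T
    using measurable_differentiable_image_eq[OF leb der injB] int im
    by (metis has_integral_integrable_integral)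
qed

lemma area_ellipse:
  assumes "M \<ge> 0" "p > 0" "q > 0"
  defines "E \<equiv> {w. (Re w / p)\<^sup>2 + (Im w / q)\<^sup>2 \<le> M\<^sup>2}"
  shows "plane ` E \<in> lmeasurable" "measure lebesgue (plane ` E) = pi * (p * q) * M\<^sup>2"
proof -
  define L where "L = (\<lambda>x::real^2. vector [p * x $ 1, q * x $ 2] :: real^2)"
  have lin: "linear L"
    by (rule linearI) (simp_all add: vec_eq_iff forall_2 L_def algebra_simps)
  have det: "det (matrix L) = p * q"
    by (simp add: det_2 matrix_def axis_def L_def)
  have mem: "x \<in> cball 0 M \<longleftrightarrow> (x$1)\<^sup>2 + (x$2)\<^sup>2 \<le> M\<^sup>2" for x :: "real^2"
  proof -
    have "(norm x)\<^sup>2 = (x$1)\<^sup>2 + (x$2)\<^sup>2"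
      by (simp add: norm_vec_def L2_set_def sum_2)
    then show ?thesis
      using \<open>M \<ge> 0\<close> abs_le_square_iff[of "norm x" M] by simp
  qed
  have E: "plane ` E = L ` cball 0 M"
  proof (intro set_eqI iffI)
    fix x assume "x \<in> plane ` E"
    then have "(x$1 / p)\<^sup>2 + (x$2 / q)\<^sup>2 \<le> M\<^sup>2" by (auto simp: E_def plane_image unplane_def)
    then have "vector [x$1 / p, x$2 / q] \<in> cball (0::real^2) M" by (simp only: mem vector_2)
    moreover have "x = L (vector [x$1 / p, x$2 / q])"
      using assms by (simp add: L_def vec_eq_iff forall_2)
    ultimately show "x \<in> L ` cball 0 M" by blast
  next
    fix x assume "x \<in> L ` cball 0 M"
    then obtain y where y: "y \<in> cball 0 M" "x = L y" by auto
    with assms show "x \<in> plane ` E" by (simp only: mem) (simp add: E_def plane_image unplane_def L_def)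
  qed
  show "plane ` E \<in> lmeasurable"
    unfolding E by (rule measurable_linear_image[OF lin lmeasurable_cball])
  have "measure lebesgue (plane ` E) = \<bar>p * q\<bar> * measure lebesgue (cball 0 M :: (real^2) set)"
    unfolding E det[symmetric] by (rule measure_linear_image[OF lin lmeasurable_cball])
  also have "measure lebesgue (cball 0 M :: (real^2) set) = pi * M\<^sup>2"
    using content_cball[OF \<open>M \<ge> 0\<close>, of "0::real^2"] by (simp add: unit_ball_vol_2)
  finally show "measure lebesgue (plane ` E) = pi * (p * q) * M\<^sup>2"
    using assms by simp
qed

section \<open>The area theorem\<close>

lemma has_integral_circle_mean_zero:
  assumes holN: "N holomorphic_on ball 0 1" and s: "0 < \<sigma>" "\<sigma> < 1"
  shows "((\<lambda>t. of_real \<sigma> * cis t * N (of_real \<sigma> * cis t)) has_integral 0) {0..2*pi}"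
proof -
  have "(N has_contour_integral 0) (circlepath 0 \<sigma>)"
    by (rule Cauchy_theorem_convex_simple[OF holN]) (use s in auto)
  then have "((\<lambda>t. N (of_real \<sigma> * cis t) * of_real \<sigma> * \<i> * cis t) has_integral 0) {0..2*pi}"
    unfolding circlepath_def by (subst (asm) has_contour_integral_part_circlepath_iff) auto
  from has_integral_mult_right[OF this, of "- \<i>"] show ?thesis
    by (simp add: mult_ac)
qed

text \<open>
  A truncated Parseval inequality. With \<open>P = - 1/z + b z\<close> and \<open>Q = P + z\<^sup>2 m\<close>, drop the last term of
  \<open>\<bar>Q\<bar>\<^sup>2 = \<bar>P\<bar>\<^sup>2 + 2 Re (cnj P z\<^sup>2 m) + \<bar>z\<^sup>2 m\<bar>\<^sup>2\<close>. On the circle, \<open>cnj z = \<sigma>\<^sup>2 / z\<close>, so the remaining terms are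
  the constant \<open>1/\<sigma>\<^sup>2 + b\<^sup>2 \<sigma>\<^sup>2\<close> plus the real part of a holomorphic function that vanishes at \<open>0\<close> and hence
  has mean zero.
\<close>
lemma circle_square_mean_ge:
  fixes m :: "complex \<Rightarrow> complex" and b :: real
  assumes holm: "m holomorphic_on ball 0 1" and s: "0 < \<sigma>" "\<sigma> < 1"
  defines "z \<equiv> \<lambda>t. of_real \<sigma> * cis t"
  shows "2 * pi * (1 / \<sigma>\<^sup>2 + b\<^sup>2 * \<sigma>\<^sup>2) \<le>
           integral {0..2*pi} (\<lambda>t. (norm (- 1 / z t + of_real b * z t + (z t)\<^sup>2 * m (z t)))\<^sup>2)"
proof -
  define c where "c = 1 / \<sigma>\<^sup>2 + b\<^sup>2 * \<sigma>\<^sup>2"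
  define N where "N = (\<lambda>z. - 2 * of_real b * z / (of_real \<sigma>)\<^sup>2 
                          + 2 * (of_real b * (of_real \<sigma>)\<^sup>2 - z\<^sup>2 / (of_real \<sigma>)\<^sup>2) * m z)"
  define Q where "Q = (\<lambda>z. - 1 / z + of_real b * z + z\<^sup>2 * m z)"
  have nz: "norm (z t) = \<sigma>" "z t \<noteq> 0" "z t \<in> ball 0 1" for t
    using s by (auto simp: z_def norm_mult)
  have low: "c + Re (z t * N (z t)) \<le> (norm (Q (z t)))\<^sup>2" for t
  proof -
    define w where "w = z t"
    have w: "w \<noteq> 0" and wc: "w * cnj w = (of_real \<sigma>)\<^sup>2"
      using nz complex_norm_square[of "z t"] by (auto simp: w_def)
    define P where "P = - 1 / w + of_real b * w"
    have cw: "cnj w = (of_real \<sigma>)\<^sup>2 / w"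
      using wc w by (simp add: field_simps)
    have cP: "cnj P = - w / (of_real \<sigma>)\<^sup>2 + of_real b * (of_real \<sigma>)\<^sup>2 / w"
      using w s by (simp add: P_def cw)
    have PP: "P * cnj P = of_real c - of_real b * (w\<^sup>2 / (of_real \<sigma>)\<^sup>2) - of_real b * ((of_real \<sigma>)\<^sup>2 / w\<^sup>2)"
      unfolding cP unfolding P_def c_def using w s
      by (simp add: field_simps power2_eq_square)
    have "(of_real \<sigma>)\<^sup>2 / w\<^sup>2 = cnj (w\<^sup>2 / (of_real \<sigma>)\<^sup>2)"
      using w s by (simp add: cw field_simps power2_eq_square)
    then have re: "Re ((of_real \<sigma>)\<^sup>2 / w\<^sup>2) = Re (w\<^sup>2 / (of_real \<sigma>)\<^sup>2)"
      by (metis complex_cnj(1) complex.sel(1) cnj.sel(1))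
    have nP: "(norm P)\<^sup>2 = c - 2 * b * Re (w\<^sup>2 / (of_real \<sigma>)\<^sup>2)"
    proof -
      have "(norm P)\<^sup>2 = Re (P * cnj P)"
        by (metis Re_complex_of_real complex_norm_square)
      also have "\<dots> = c - 2 * b * Re (w\<^sup>2 / (of_real \<sigma>)\<^sup>2)"
        proof -
        have "Re (of_real c - of_real b * u - of_real b * v) = c - 2 * b * Re u" if "Re v = Re u" for u v
          using that by simp
        from this[OF re] show ?thesis unfolding PP .
      qed
      finally show ?thesis .
    qed
    have "w * N w = - 2 * of_real b * (w\<^sup>2 / (of_real \<sigma>)\<^sup>2) + 2 * (cnj P * (w\<^sup>2 * m w))"
      unfolding cP N_def using w s by (simp add: field_simps power2_eq_square)
    then have re2: "Re (w * N w) = - 2 * b * Re (w\<^sup>2 / (of_real \<sigma>)\<^sup>2) + 2 * Re (cnj P * (w\<^sup>2 * m w))"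
      by simp
    have "(norm (Q w))\<^sup>2 = (norm P)\<^sup>2 + (norm (w\<^sup>2 * m w))\<^sup>2 + 2 * Re (cnj P * (w\<^sup>2 * m w))"
      unfolding Q_def P_def[symmetric] cmod_power2 by (simp add: power2_eq_square algebra_simps)
    then show ?thesis
      using re2 nP by (simp add: w_def)
  qed
  have holN: "N holomorphic_on ball 0 1"
    unfolding N_def using s by (intro holomorphic_intros holm) auto
  have "((\<lambda>t. Re (z t * N (z t))) has_integral 0) {0..2*pi}"
    using has_integral_Re[OF has_integral_circle_mean_zero[OF holN s]] by (simp add: z_def)
  then have I: "((\<lambda>t. c + Re (z t * N (z t))) has_integral 2 * pi * c) {0..2*pi}"
    using has_integral_add[OF has_integral_const_real[of c 0 "2*pi"]] by fastforce
  have "continuous_on {0..2*pi} (\<lambda>t. (norm (Q (z t)))\<^sup>2)"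
    unfolding Q_def
    by (intro continuous_intros continuous_on_compose2[OF holomorphic_on_imp_continuous_on[OF holm]])
      (use nz in \<open>auto simp: z_def intro!: continuous_intros\<close>)
  then have "(\<lambda>t. (norm (Q (z t)))\<^sup>2) integrable_on {0..2*pi}"
    by (rule integrable_continuous_real)
  then show ?thesis
    using has_integral_le[OF I integrable_integral] low unfolding Q_def c_def by blast
qed

text \<open>
  If \<open>1 / h\<close> maps the circle \<open>\<bar>z\<bar> = \<epsilon>\<close> into \<open>K\<close>, then the part of the complement of \<open>K\<close> covered by
  \<open>1 / h\<close> on the punctured disc \<open>0 < \<bar>z\<bar> < \<epsilon>\<close> is open, relatively closed, and nonempty because \<open>1 / h\<close> covers a
  neighbourhood of infinity. The complement of \<open>K\<close> is connected, so all of it is covered, and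
  injectivity leaves nothing of it for the points outside the circle.
\<close>
lemma reciprocal_image_subset_convex:
  assumes holh: "h holomorphic_on ball 0 1" and inj: "inj_on h (ball 0 1)" and h0: "h 0 = 0"
    and K: "compact K" "convex K" "0 \<in> K"
    and e: "0 < \<epsilon>" "\<epsilon> < 1"
    and circ: "\<And>z. norm z = \<epsilon> \<Longrightarrow> 1 / h z \<in> K"
    and z: "\<epsilon> < norm z" "norm z < 1"
  shows "1 / h z \<in> K"
proof (rule ccontr)
  assume notK: "1 / h z \<notin> K"
  define A where "A = - K \<inter> (\<lambda>w. 1 / w) -` (h ` ball 0 \<epsilon>)"
  have sub: "ball 0 \<epsilon> \<subseteq> ball (0::complex) 1" "cball 0 \<epsilon> \<subseteq> ball (0::complex) 1"
    using e by auto
  have opn: "open (h ` ball 0 \<epsilon>)"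
    using open_mapping_thm3[OF holomorphic_on_subset[OF holh sub(1)]] inj_on_subset[OF inj sub(1)] by simp
  have cmp: "compact (h ` cball 0 \<epsilon>)"
    by (intro compact_continuous_image compact_cball 
        holomorphic_on_imp_continuous_on[OF holomorphic_on_subset[OF holh sub(2)]])
  have A2: "A = - K \<inter> (\<lambda>w. 1 / w) -` (h ` cball 0 \<epsilon>)"
  proof -
    have "w \<in> K" if "1 / w = h u" "norm u \<le> \<epsilon>" "\<not> norm u < \<epsilon>" for w u
      using circ[of u] that by (metis divide_divide_eq_right div_by_1 mult_1 not_less order_antisym)
    then show ?thesis unfolding A_def by fastforce
  qed
  have cont: "continuous_on (- K) (\<lambda>w. 1 / w)"
    using K(3) by (intro continuous_intros) auto
  have "openin (top_of_set (- K)) A"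
    unfolding A_def by (rule continuous_openin_preimage_gen[OF cont opn])
  moreover have "closedin (top_of_set (- K)) A"
    unfolding A2 by (rule continuous_closedin_preimage[OF cont compact_imp_closed[OF cmp]])
  moreover have "connected (- K)"
    by (rule connected_complement_bounded_convex) (use K compact_imp_bounded in auto)
  ultimately have "A = {} \<or> A = - K"
    by (simp add: connected_clopen)
  moreover have "A \<noteq> {}"
  proof -
    have "0 \<in> h ` ball 0 \<epsilon>" using e h0 by force
    then obtain d where d: "d > 0" "ball 0 d \<subseteq> h ` ball 0 \<epsilon>"
      using opn open_contains_ball by blast
    obtain B where B: "\<And>w. w \<in> K \<Longrightarrow> norm w \<le> B" 
      using K(1) compact_imp_bounded bounded_iff by metis
    (* The real number R is too large to lie in K, and its reciprocal is covered by h. *)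
    define R where "R = \<bar>B\<bar> + 1 / d + 1"
    have R: "R > B" "R > 1 / d" "R > 0" using divide_pos_pos[OF zero_less_one d(1)] unfolding R_def by linarith+ 
    have "complex_of_real R \<notin> K" using B[of "of_real R"] R by auto
    moreover have "1 / complex_of_real R \<in> ball 0 d"
      using R d by (simp add: norm_divide field_simps)
    ultimately have "of_real R \<in> A" using d unfolding A_def by auto
    then show ?thesis by blast
  qed
  ultimately have "1 / h z \<in> A" using notK by auto
  then obtain u where u: "norm u < \<epsilon>" "h z = h u" by (auto simp: A_def)
  then show False
    using inj_onD[OF inj u(2)] z e by auto
qed

text \<open>
  Multiplied by \<open>\<pi>\<close>, the two sides bound the area of the image of the slit annulus \<open>\<epsilon> < \<bar>z\<bar> < \<rho>\<close> under
  \<open>1 / h\<close> from below and from above. In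
  the coordinate \<open>z = exp (s + i t)\<close> the annulus becomes a box, and the area becomes an iterated
  integral of circle means.
\<close>
lemma reciprocal_area_bounds:
  fixes h k :: "complex \<Rightarrow> complex" and b :: real
  assumes holh: "h holomorphic_on ball 0 1" and inj: "inj_on h (ball 0 1)" and h0: "h 0 = 0"
    and holk: "k holomorphic_on ball 0 1"
    and eq: "\<And>z. z \<in> ball 0 1 - {0} \<Longrightarrow> 1 / h z = 1 / z + of_real b * z + z\<^sup>2 * k z"
    and B: "\<And>z. norm z \<le> 1/2 \<Longrightarrow> norm (k z) \<le> B"
    and e: "0 < \<epsilon>" "\<epsilon> < 1/2" "\<bar>b\<bar> * \<epsilon>\<^sup>2 \<le> 1/2" and r: "1/2 < \<rho>" "\<rho> < 1"
  shows "1 / \<epsilon>\<^sup>2 - 1 / \<rho>\<^sup>2 + b\<^sup>2 * (\<rho>\<^sup>2 - \<epsilon>\<^sup>2) 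
           \<le> (1 / \<epsilon>\<^sup>2 - b\<^sup>2 * \<epsilon>\<^sup>2) * (1 + 2 * B * \<epsilon> ^ 3)\<^sup>2"
proof -
  define U where "U = {z. Re z < 0}"
  define \<Phi> where "\<Phi> = (\<lambda>z. 1 / h (exp z))"
  define m where "m = (\<lambda>z. 2 * k z + z * deriv k z)"
  define X where "X = box (Complex (ln \<epsilon>) 0) (Complex (ln \<rho>) (2*pi))"
  have B0: "B \<ge> 0" using order_trans[OF norm_ge_zero B[of 0]] by simp
  have exp_in: "exp z \<in> ball 0 1 - {0}" if "z \<in> U" for z
    using that by (simp add: U_def)
  have openU: "open U" unfolding U_def by (rule open_halfspace_Re_lt)
  have h_nz: "h z \<noteq> 0" if "z \<in> ball 0 1 - {0}" for z
    using inj_onD[OF inj, of z 0] that h0 by auto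
  have hol\<Phi>: "\<Phi> holomorphic_on U"
  proof -
    have "exp ` U \<subseteq> ball 0 1"
      using exp_in by blast
    then have "(\<lambda>z. h (exp z)) holomorphic_on U"
      by (rule holomorphic_on_compose_gen[OF holomorphic_on_exp holh, unfolded o_def])
    then show ?thesis
      unfolding \<Phi>_def using exp_in h_nz by (intro holomorphic_intros) auto
  qed
  have d\<Phi>: "deriv \<Phi> z = - 1 / exp z + of_real b * exp z + (exp z)\<^sup>2 * m (exp z)" if "z \<in> U" for z
  proof -
    have "(k has_field_derivative deriv k (exp z)) (at (exp z))"
      using exp_in[OF that] by (intro holomorphic_derivI[OF holk]) auto
    then have 1: "((\<lambda>z. k (exp z)) has_field_derivative deriv k (exp z) * exp z) (at z)"
      by (rule DERIV_chain2) (rule DERIV_exp)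
    have "((\<lambda>z. exp (- z) + of_real b * exp z + (exp z)\<^sup>2 * k (exp z)) has_field_derivative
            (exp (- z) * (- 1) + of_real b * exp z + 
              ((exp z)\<^sup>2 * (deriv k (exp z) * exp z) + (of_nat 2 * (exp z * exp z ^ (2 - Suc 0))) * k (exp z)))) (at z)"
      by (intro DERIV_add DERIV_cmult DERIV_mult' 1 DERIV_power DERIV_exp 
          DERIV_chain2[OF DERIV_exp DERIV_minus[OF DERIV_ident]])
    moreover have "exp (- z) * (- 1) + of_real b * exp z + 
              ((exp z)\<^sup>2 * (deriv k (exp z) * exp z) + (of_nat 2 * (exp z * exp z ^ (2 - Suc 0))) * k (exp z)) =
              - 1 / exp z + of_real b * exp z + (exp z)\<^sup>2 * m (exp z)"
      by (simp add: m_def exp_minus divide_inverse) (simp add: power2_eq_square algebra_simps)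
    ultimately have "((\<lambda>z. exp (- z) + of_real b * exp z + (exp z)\<^sup>2 * k (exp z)) has_field_derivative
            (- 1 / exp z + of_real b * exp z + (exp z)\<^sup>2 * m (exp z))) (at z)"
      by (simp only:)
    then have "(\<Phi> has_field_derivative (- 1 / exp z + of_real b * exp z + (exp z)\<^sup>2 * m (exp z))) (at z)"
      by (rule has_field_derivative_transform_within_open[OF _ openU that])
         (use eq[OF exp_in] in \<open>simp add: \<Phi>_def exp_minus divide_inverse\<close>)
    then show ?thesis by (rule DERIV_imp_deriv)
  qed
  have holm: "m holomorphic_on ball 0 1"
    unfolding m_def by (intro holomorphic_intros holk) auto
  have lnr: "ln \<rho> < 0" "ln \<epsilon> < ln \<rho>"
    using e r by auto
  have subU: "cbox (Complex (ln \<epsilon>) 0) (Complex (ln \<rho>) (2*pi)) \<subseteq> U"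
    using lnr by (auto simp: U_def in_cbox_complex_iff)
  have XU: "X \<subseteq> U" unfolding X_def using subU box_subset_cbox by blast
  have inj\<Phi>: "inj_on \<Phi> X"
  proof (rule inj_onI)
    fix x y assume xy: "x \<in> X" "y \<in> X" "\<Phi> x = \<Phi> y"
    then have "h (exp x) = h (exp y)" by (simp add: \<Phi>_def)
    then have "exp x = exp y"
      using inj_onD[OF inj] exp_in XU xy by blast
    moreover have "\<bar>Im x - Im y\<bar> < 2 * pi"
      using xy by (auto simp: X_def in_box_complex_iff)
    ultimately show "x = y" by (metis exp_complex_eqI)
  qed
  define J where "J = (\<lambda>s. integral {0..2*pi} (\<lambda>t. (norm (deriv \<Phi> (Complex s t)))\<^sup>2))"
  have area: "plane ` \<Phi> ` X \<in> lmeasurable"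
             "measure lebesgue (plane ` \<Phi> ` X) = integral {ln \<epsilon>..ln \<rho>} J"
    using area_conformal_image[OF hol\<Phi> openU subU] inj\<Phi> unfolding X_def J_def by auto
  \<comment> \<open>The circle means over \<open>\<bar>z\<bar> = exp s\<close> are bounded below and integrated over \<open>s\<close>; \<open>G\<close> is a
      primitive of the resulting bound.\<close>
  have J_ge: "2 * pi * (exp (- 2 * s) + b\<^sup>2 * exp (2 * s)) \<le> J s" if "s \<in> {ln \<epsilon>..ln \<rho>}" for s
  proof -
    have s: "0 < exp s" "exp s < 1" using that lnr by auto
    have "deriv \<Phi> (Complex s t) = - 1 / (of_real (exp s) * cis t) + of_real b * (of_real (exp s) * cis t)
            + (of_real (exp s) * cis t)\<^sup>2 * m (of_real (exp s) * cis t)" for t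
      using that lnr d\<Phi>[of "Complex s t"] by (simp add: U_def exp_eq_polar)
    moreover have "1 / (exp s)\<^sup>2 = exp (- 2 * s)" "(exp s)\<^sup>2 = exp (2 * s)"
      by (simp_all only: exp_double mult_minus_left exp_minus inverse_eq_divide)
    ultimately show ?thesis
      using circle_square_mean_ge[OF holm s, of b] by (simp add: J_def)
  qed
  have "continuous_on ({ln \<epsilon>..ln \<rho>} \<times> cbox 0 (2*pi)) (\<lambda>(s, t). (norm (deriv \<Phi> (Complex s t)))\<^sup>2)"
    unfolding case_prod_beta
    by (intro continuous_intros continuous_on_compose2[OF holomorphic_on_imp_continuous_on
          [OF holomorphic_deriv[OF hol\<Phi> openU]]])
       (use lnr in \<open>auto simp: U_def Complex_eq intro!: continuous_intros\<close>)
  then have "continuous_on {ln \<epsilon>..ln \<rho>} J"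
    unfolding J_def using integral_continuous_on_param[of "{ln \<epsilon>..ln \<rho>}" 0 "2*pi"] by auto
  then have J_int: "(J has_integral integral {ln \<epsilon>..ln \<rho>} J) {ln \<epsilon>..ln \<rho>}"
    using integrable_continuous_real integrable_integral by blast
  define G where "G = (\<lambda>s. pi * (- exp (- 2 * s) + b\<^sup>2 * exp (2 * s)))"
  have G: "((\<lambda>s. 2 * pi * (exp (- 2 * s) + b\<^sup>2 * exp (2 * s))) has_integral (G (ln \<rho>) - G (ln \<epsilon>))) {ln \<epsilon>..ln \<rho>}"
    unfolding G_def
    by (rule fundamental_theorem_of_calculus)
       (use lnr in \<open>auto simp: algebra_simps has_real_derivative_iff_has_vector_derivative[symmetric]
          intro!: derivative_eq_intros\<close>)
  have Gval: "G (ln x) = pi * (- 1 / x\<^sup>2 + b\<^sup>2 * x\<^sup>2)" if "x > 0" for x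
    using that unfolding G_def by (simp only: exp_double mult_minus_left exp_minus inverse_eq_divide exp_ln)
      simp
  have low: "pi * (1 / \<epsilon>\<^sup>2 - 1 / \<rho>\<^sup>2 + b\<^sup>2 * (\<rho>\<^sup>2 - \<epsilon>\<^sup>2)) \<le> measure lebesgue (plane ` \<Phi> ` X)"
  proof -
    have "G (ln \<rho>) - G (ln \<epsilon>) \<le> integral {ln \<epsilon>..ln \<rho>} J"
      by (rule has_integral_le[OF G J_int J_ge])
    then show ?thesis
      using e r by (simp add: area Gval algebra_simps)
  qed
  \<comment> \<open>The principal part \<open>1/z + b z\<close> maps the circle \<open>\<bar>z\<bar> = \<epsilon>\<close> onto the ellipse with semi-axes \<open>p\<close> and \<open>q\<close>.
      Relative to these axes the remainder \<open>z\<^sup>2 k z\<close> has size at most \<open>B \<epsilon>\<^sup>2 * 2 \<epsilon>\<close>, whence the factor \<open>M\<close>.\<close>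
  define p where "p = 1 / \<epsilon> + b * \<epsilon>"
  define q where "q = 1 / \<epsilon> - b * \<epsilon>"
  define M where "M = 1 + 2 * B * \<epsilon> ^ 3"
  define K where "K = {w. (Re w / p)\<^sup>2 + (Im w / q)\<^sup>2 \<le> M\<^sup>2}"
  have M: "M \<ge> 0" using B0 e by (simp add: M_def)
  have be: "\<bar>b * \<epsilon>\<bar> \<le> 1 / (2 * \<epsilon>)"
    using e by (simp add: abs_mult field_simps power2_eq_square)
  then have pq: "p \<ge> 1 / (2 * \<epsilon>)" "q \<ge> 1 / (2 * \<epsilon>)"
    unfolding p_def q_def by (simp_all add: abs_le_iff)
  have "1 / (2 * \<epsilon>) > 0" using e by simp
  then have pq0: "p > 0" "q > 0" using pq by linarith+
  define L where "L = (\<lambda>w. Complex (p * Re w) (q * Im w))"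
  have L: "linear L" unfolding L_def by (rule linearI) (auto simp: complex_eq_iff algebra_simps)
  have K_eq: "K = {w. norm (Complex (Re w / p) (Im w / q)) \<le> M}"
  proof -
    have "norm u \<le> M \<longleftrightarrow> (Re u)\<^sup>2 + (Im u)\<^sup>2 \<le> M\<^sup>2" for u
      using M abs_le_square_iff[of "norm u" M] by (simp add: cmod_power2)
    then show ?thesis by (simp add: K_def)
  qed
  have KL: "K = L ` cball 0 M"
  proof (intro set_eqI iffI)
    fix w assume "w \<in> K"
    moreover have "w = L (Complex (Re w / p) (Im w / q))"
      using pq0 by (simp add: L_def)
    ultimately show "w \<in> L ` cball 0 M" by (auto simp: K_eq)
  next
    fix w assume "w \<in> L ` cball 0 M"
    then show "w \<in> K" using pq0 by (auto simp: K_eq L_def)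
  qed
  have K: "compact K" "convex K" "0 \<in> K"
  proof -
    show "compact K"
      unfolding KL by (intro compact_continuous_image linear_continuous_on compact_cball)
        (use L in \<open>simp add: linear_conv_bounded_linear\<close>)
    show "convex K"
      unfolding KL by (rule convex_linear_image[OF L convex_cball])
    show "0 \<in> K"
      using M by (simp add: K_def)
  qed
  have circ: "1 / h z \<in> K" if z: "norm z = \<epsilon>" for z
  proof -
    define d where "d = z\<^sup>2 * k z"
    have zin: "z \<in> ball 0 1 - {0}" using z e by auto
    have nd: "norm d \<le> B * \<epsilon>\<^sup>2"
      using B[of z] z e by (simp add: d_def norm_mult norm_power mult.commute mult_left_mono)
    have iz: "1 / z = cnj z / of_real (\<epsilon>\<^sup>2)"
      using zin z complex_norm_square[of z] by (simp add: field_simps)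
    have "Re (1 / h z) = Re z / \<epsilon> * p + Re d" "Im (1 / h z) = - (Im z / \<epsilon>) * q + Im d"
      unfolding eq[OF zin] d_def[symmetric] iz using e
      by (simp_all add: p_def q_def field_simps power2_eq_square)
    then have "Complex (Re (1 / h z) / p) (Im (1 / h z) / q) = cnj z / of_real \<epsilon> + Complex (Re d / p) (Im d / q)"
      using pq0 by (simp add: complex_eq_iff field_simps)
    moreover have "norm (Complex (Re d / p) (Im d / q)) \<le> 2 * \<epsilon> * norm d"
    proof -
      have 1: "\<bar>x / p\<bar> \<le> 2 * \<epsilon> * \<bar>x\<bar>" "\<bar>x / q\<bar> \<le> 2 * \<epsilon> * \<bar>x\<bar>" for x
      proof -
        have "1 / p \<le> 2 * \<epsilon>" "1 / q \<le> 2 * \<epsilon>"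
          using pq pq0 e by (simp_all add: field_simps)
        from this[THEN mult_left_mono, of "\<bar>x\<bar>"]
        have "\<bar>x\<bar> * (1 / p) \<le> \<bar>x\<bar> * (2 * \<epsilon>)" "\<bar>x\<bar> * (1 / q) \<le> \<bar>x\<bar> * (2 * \<epsilon>)"
          by simp_all
        then show "\<bar>x / p\<bar> \<le> 2 * \<epsilon> * \<bar>x\<bar>" "\<bar>x / q\<bar> \<le> 2 * \<epsilon> * \<bar>x\<bar>"
          using pq0 by (simp_all add: mult_ac)
      qed
      have "(norm (Complex (Re d / p) (Im d / q)))\<^sup>2 \<le> (2 * \<epsilon> * norm d)\<^sup>2"
        using power_mono[OF 1(1)[of "Re d"], of 2] power_mono[OF 1(2)[of "Im d"], of 2]
        unfolding power_mult_distrib cmod_power2 by (simp add: distrib_left power_divide)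
      then show ?thesis
        using e by (simp add: abs_le_square_iff[symmetric])
    qed
    moreover have "norm (cnj z / of_real \<epsilon>) = 1" using z e by (simp add: norm_divide)
    ultimately have "norm (Complex (Re (1 / h z) / p) (Im (1 / h z) / q)) \<le> 1 + 2 * \<epsilon> * norm d"
      by (metis add_left_mono norm_triangle_le)
    also have "\<dots> \<le> M"
      using mult_left_mono[OF nd, of "2 * \<epsilon>"] e
      by (simp add: M_def power2_eq_square power3_eq_cube algebra_simps)
    finally show ?thesis by (simp add: K_eq)
  qed
  have "\<Phi> ` X \<subseteq> K"
  proof
    fix w assume "w \<in> \<Phi> ` X"
    then obtain \<zeta> where \<zeta>: "\<zeta> \<in> X" "w = 1 / h (exp \<zeta>)" by (auto simp: \<Phi>_def)
    then have "ln \<epsilon> < Re \<zeta>" "Re \<zeta> < 0" using lnr by (auto simp: X_def in_box_complex_iff)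
    then have "\<epsilon> < norm (exp \<zeta>)" "norm (exp \<zeta>) < 1"
      using e by (simp_all, metis exp_less_mono exp_ln)
    then show "w \<in> K"
      unfolding \<zeta> using reciprocal_image_subset_convex[OF holh inj h0 K e(1) _ circ] e by auto
  qed
  then have "measure lebesgue (plane ` \<Phi> ` X) \<le> measure lebesgue (plane ` K)"
    by (intro measure_mono_fmeasurable image_mono)
       (use area area_ellipse[OF M pq0] in \<open>auto simp: K_def fmeasurableD\<close>)
  also have "\<dots> = pi * (p * q) * M\<^sup>2"
    using area_ellipse[OF M pq0] by (simp add: K_def)
  also have "p * q = 1 / \<epsilon>\<^sup>2 - b\<^sup>2 * \<epsilon>\<^sup>2"
    by (simp add: p_def q_def algebra_simps power2_eq_square)
  finally have "pi * (1 / \<epsilon>\<^sup>2 - 1 / \<rho>\<^sup>2 + b\<^sup>2 * (\<rho>\<^sup>2 - \<epsilon>\<^sup>2))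
      \<le> pi * ((1 / \<epsilon>\<^sup>2 - b\<^sup>2 * \<epsilon>\<^sup>2) * (1 + 2 * B * \<epsilon> ^ 3)\<^sup>2)"
    using order_trans[OF low] by (simp only: M_def mult.assoc)
  then show ?thesis
    by (rule mult_left_le_imp_le) simp
qed

text \<open>
  Gronwall's inequality for the coefficient \<open>b\<close> alone, with \<open>b\<close> real: let \<open>\<epsilon>\<close> tend to \<open>0\<close> and then \<open>\<rho>\<close> to
  \<open>1\<close> in the two area bounds. The terms \<open>1 / \<epsilon>\<^sup>2\<close> cancel and the error is \<open>O(\<epsilon>)\<close>.
\<close>
theorem area_theorem:
  fixes h k :: "complex \<Rightarrow> complex" and b :: real
  assumes holh: "h holomorphic_on ball 0 1" and inj: "inj_on h (ball 0 1)" and h0: "h 0 = 0"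
    and holk: "k holomorphic_on ball 0 1"
    and eq: "\<And>z. z \<in> ball 0 1 - {0} \<Longrightarrow> 1 / h z = 1 / z + of_real b * z + z\<^sup>2 * k z"
  shows "\<bar>b\<bar> \<le> 1"
proof -
  have "compact (k ` cball 0 (1/2))"
    by (intro compact_continuous_image holomorphic_on_imp_continuous_on[OF holomorphic_on_subset[OF holk]]) auto
  then obtain B where B: "\<And>z. norm z \<le> 1/2 \<Longrightarrow> norm (k z) \<le> B"
    by (metis bounded_iff compact_imp_bounded dist_0_norm image_eqI mem_cball)
  have B0: "B \<ge> 0" using order_trans[OF norm_ge_zero B[of 0]] by simp
  have fin: "b\<^sup>2 * \<rho>\<^sup>2 \<le> 1 / \<rho>\<^sup>2" if r: "1/2 < \<rho>" "\<rho> < 1" for \<rho> :: real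
  proof (rule tendsto_le[OF trivial_limit_at_right_real])
    show "((\<lambda>\<epsilon>. 1 / \<rho>\<^sup>2 + (4 * B * \<epsilon> + 4 * B\<^sup>2 * \<epsilon> ^ 4)) \<longlongrightarrow> 1 / \<rho>\<^sup>2) (at_right 0)"
      by (auto intro!: tendsto_eq_intros)
    show "((\<lambda>\<epsilon>. b\<^sup>2 * \<rho>\<^sup>2) \<longlongrightarrow> b\<^sup>2 * \<rho>\<^sup>2) (at_right (0::real))"
      by (rule tendsto_const)
    have "eventually (\<lambda>\<epsilon>. \<bar>b\<bar> * \<epsilon>\<^sup>2 < 1/2) (at_right (0::real))"
      by (rule order_tendstoD[of _ 0]) (auto intro!: tendsto_eq_intros)
    moreover have "eventually (\<lambda>\<epsilon>. 0 < \<epsilon> \<and> \<epsilon> < 1/2) (at_right (0::real))"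
      using eventually_at_right_less[of "0::real"] 
        eventually_at_right_field[of "\<lambda>x. x < 1/2" "0::real"] by (auto intro!: eventually_conj exI[of _ "1/2"])
    ultimately show "eventually (\<lambda>\<epsilon>. b\<^sup>2 * \<rho>\<^sup>2 \<le> 1 / \<rho>\<^sup>2 + (4 * B * \<epsilon> + 4 * B\<^sup>2 * \<epsilon> ^ 4)) (at_right 0)"
    proof eventually_elim
      case (elim \<epsilon>)
      define t where "t = 4 * B * \<epsilon> ^ 3 + 4 * B\<^sup>2 * \<epsilon> ^ 6"
      have t: "t \<ge> 0" "(1 + 2 * B * \<epsilon> ^ 3)\<^sup>2 = 1 + t"
        using B0 elim by (auto simp: t_def power2_eq_square algebra_simps power_add[symmetric])
      have "b\<^sup>2 * \<rho>\<^sup>2 - 1 / \<rho>\<^sup>2 \<le> (1 / \<epsilon>\<^sup>2 - b\<^sup>2 * \<epsilon>\<^sup>2) * t"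
      proof -
        have "1 / \<epsilon>\<^sup>2 - 1 / \<rho>\<^sup>2 + b\<^sup>2 * (\<rho>\<^sup>2 - \<epsilon>\<^sup>2) \<le> (1 / \<epsilon>\<^sup>2 - b\<^sup>2 * \<epsilon>\<^sup>2) * (1 + t)"
          unfolding t(2)[symmetric]
          by (rule reciprocal_area_bounds[OF holh inj h0 holk eq B]) (use elim r in auto)
        moreover have "x - y \<le> (u - v) * t" if "u - y + (x - v) \<le> (u - v) * (1 + t)" for u v x y :: real
          using that by (simp add: algebra_simps)
        ultimately show ?thesis by (simp only: right_diff_distrib)
      qed
      also have "\<dots> \<le> 1 / \<epsilon>\<^sup>2 * t"
        using t elim by (intro mult_right_mono) auto
      also have "\<dots> = 4 * B * \<epsilon> + 4 * B\<^sup>2 * \<epsilon> ^ 4"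
        using elim by (simp add: t_def field_simps power_numeral_reduce)
      finally show ?case by simp
    qed
  qed
  have "b\<^sup>2 * 1\<^sup>2 \<le> 1 / 1\<^sup>2"
  proof (rule tendsto_le[of "at_left (1::real)"])
    show "((\<lambda>\<rho>. b\<^sup>2 * \<rho>\<^sup>2) \<longlongrightarrow> b\<^sup>2 * 1\<^sup>2) (at_left 1)" "((\<lambda>\<rho>::real. 1 / \<rho>\<^sup>2) \<longlongrightarrow> 1 / 1\<^sup>2) (at_left 1)"
      by (auto intro!: tendsto_eq_intros)
    have "eventually (\<lambda>\<rho>::real. \<rho> \<in> {1/2<..<1}) (at_left 1)"
      by (rule eventually_at_left_real) simp
    then show "eventually (\<lambda>\<rho>::real. b\<^sup>2 * \<rho>\<^sup>2 \<le> 1 / \<rho>\<^sup>2) (at_left 1)"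
      by eventually_elim (use fin in auto)
  qed auto
  then show ?thesis
    by (simp add: abs_square_le_1)
qed

section \<open>The second coefficient of univalent functions\<close>

lemma deriv2_eqI:
  assumes S: "open S" "x \<in> S"
    and f: "\<And>z. z \<in> S \<Longrightarrow> (f has_field_derivative F z) (at z)"
    and F: "(F has_field_derivative D) (at x)"
  shows "deriv (deriv f) x = D"
proof -
  have "(deriv f has_field_derivative D) (at x)"
    using F S by (rule has_field_derivative_transform_within_open) (simp add: DERIV_imp_deriv[OF f])
  then show ?thesis by (rule DERIV_imp_deriv)
qed

lemma disc_dilation_derivs:
  assumes holf: "f holomorphic_on ball 0 1" and c: "c \<noteq> 0" "norm c \<le> 1"
  defines "F \<equiv> \<lambda>z. f (c * z) / c"
  shows "F holomorphic_on ball 0 1"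
    and "z \<in> ball 0 1 \<Longrightarrow> deriv F z = deriv f (c * z)"
    and "z \<in> ball 0 1 \<Longrightarrow> deriv (deriv F) z = c * deriv (deriv f) (c * z)"
proof -
  have cz: "c * z \<in> ball 0 1" if "z \<in> ball 0 1" for z
    using that c le_less_trans[OF mult_left_le_one_le[of "norm z" "norm c"]] by (simp add: norm_mult)
  have der: "((\<lambda>z. g (c * z)) has_field_derivative deriv g (c * z) * c) (at z)"
    if "g holomorphic_on ball 0 1" "z \<in> ball 0 1" for g z
    using cz[OF that(2)]
    by (intro DERIV_chain2[OF holomorphic_derivI[OF that(1) open_ball]] DERIV_cmult_Id) auto
  have F: "(F has_field_derivative deriv f (c * z)) (at z)" if "z \<in> ball 0 1" for z
    using DERIV_cdivide[OF der[OF holf that], of c] c by (simp add: F_def)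
  then show "F holomorphic_on ball 0 1"
    by (meson holomorphic_on_open open_ball)
  show "z \<in> ball 0 1 \<Longrightarrow> deriv F z = deriv f (c * z)"
    by (rule DERIV_imp_deriv[OF F])
  show "z \<in> ball 0 1 \<Longrightarrow> deriv (deriv F) z = c * deriv (deriv f) (c * z)"
    unfolding mult.commute[of c "deriv (deriv f) (c * z)"]
    by (rule deriv2_eqI[OF open_ball[of 0 1] _ F der[OF holomorphic_deriv[OF holf open_ball]]])
qed

lemma disc_holomorphic_log:
  assumes holf: "f holomorphic_on ball 0 1" and nz: "\<And>z. z \<in> ball 0 1 \<Longrightarrow> f z \<noteq> 0" and f0: "f 0 = 1"
  obtains L where "L holomorphic_on ball 0 1" "L 0 = 0" "\<And>z. z \<in> ball 0 1 \<Longrightarrow> f z = exp (L z)"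
    "\<And>z. z \<in> ball 0 1 \<Longrightarrow> deriv L z = deriv f z / f z"
proof -
  obtain g where g: "g holomorphic_on ball 0 1" "\<And>z. z \<in> ball 0 1 \<Longrightarrow> f z = exp (g z)"
    by (rule contractible_imp_holomorphic_log[OF holf convex_imp_contractible[OF convex_ball] nz]) (assumption, rule that)
  define L where "L = (\<lambda>z. g z - g 0)"
  have holL: "L holomorphic_on ball 0 1"
    unfolding L_def by (intro holomorphic_intros g)
  have "exp (g 0) = 1" using g(2)[of 0] f0 by simp
  then have L: "f z = exp (L z)" if "z \<in> ball 0 1" for z
    using g(2)[OF that] by (simp add: L_def exp_diff)
  have "deriv L z = deriv f z / f z" if z: "z \<in> ball 0 1" for z
  proof -
    have "((\<lambda>z. exp (L z)) has_field_derivative exp (L z) * deriv L z) (at z)"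
      by (rule DERIV_chain2[OF DERIV_exp holomorphic_derivI[OF holL open_ball z]])
    then have "(f has_field_derivative exp (L z) * deriv L z) (at z)"
      by (rule has_field_derivative_transform_within_open[OF _ open_ball z]) (simp add: L)
    then show ?thesis using L[OF z] by (simp add: DERIV_imp_deriv)
  qed
  then show thesis
    using L by (intro that[OF holL]) (simp_all add: L_def)
qed

lemma disc_difference_quotient:
  assumes "f holomorphic_on ball 0 1"
  obtains F where "F holomorphic_on ball 0 1" "F 0 = deriv f 0" 
    "\<And>z. z \<in> ball 0 1 \<Longrightarrow> f z = f 0 + z * F z"
proof (rule that)
  show "(\<lambda>z. if z = 0 then deriv f 0 else (f z - f 0) / (z - 0)) holomorphic_on ball 0 1"
    by (rule pole_lemma_open[OF assms open_ball])
qed simp_all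

lemma class_S_D:
  assumes "g \<in> class_S"
  shows "g holomorphic_on ball 0 1" "g 0 = 0" "deriv g 0 = 1" "inj_on g (ball 0 1)"
    "z \<in> ball 0 1 \<Longrightarrow> deriv g z \<noteq> 0"
proof -
  show *: "g holomorphic_on ball 0 1" "g 0 = 0" "deriv g 0 = 1" "inj_on g (ball 0 1)"
    using assms by (simp_all add: class_S_def class_A_def)
  show "z \<in> ball 0 1 \<Longrightarrow> deriv g z \<noteq> 0"
    by (rule holomorphic_injective_imp_regular[OF *(1) open_ball *(4)])
qed

text \<open>
  The square-root transform \<open>h z = sqrt (g (z\<^sup>2))\<close> is again univalent, and it is odd, so that
  \<open>1 / h z = 1 / z - (a / 4) z + O(z\<^sup>3)\<close> has the form required by the area theorem.
\<close>
lemma second_coefficient_real_bound: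
  assumes g: "g \<in> class_S" and a: "deriv (deriv g) 0 = of_real a"
  shows "\<bar>a\<bar> \<le> 4"
proof -
  note S = class_S_D[OF g]
  obtain p where p: "p holomorphic_on ball 0 1" "p 0 = 1" 
    "\<And>z. z \<in> ball 0 1 \<Longrightarrow> g z = z * p z"
    using disc_difference_quotient[OF S(1)] S(2,3) by auto
  have pnz: "p z \<noteq> 0" if z: "z \<in> ball 0 1" for z
    using p(2,3) S(2) inj_onD[OF S(4), of z 0] z by fastforce
  obtain L where L: "L holomorphic_on ball 0 1" "L 0 = 0" "\<And>z. z \<in> ball 0 1 \<Longrightarrow> p z = exp (L z)"
    using disc_holomorphic_log[OF p(1) pnz p(2)] by metis
  have L': "(L has_field_derivative deriv L z) (at z)" if "z \<in> ball 0 1" for z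
    using holomorphic_derivI[OF L(1) open_ball that] .
  have L'': "(deriv L has_field_derivative deriv (deriv L) 0) (at 0)"
    by (rule holomorphic_derivI[OF holomorphic_deriv[OF L(1)] open_ball]) auto
  have eL: "((\<lambda>z. exp (L z)) has_field_derivative exp (L z) * deriv L z) (at z)" if "z \<in> ball 0 1" for z
    by (rule DERIV_chain2[OF DERIV_exp L'[OF that]])
  have "deriv (deriv g) 0 = 2 * deriv L 0"
  proof (rule deriv2_eqI[of "ball 0 1"])
    show "(g has_field_derivative z * (exp (L z) * deriv L z) + 1 * exp (L z)) (at z)" if "z \<in> ball 0 1" for z
      by (rule has_field_derivative_transform_within_open[OF DERIV_mult'[OF DERIV_ident eL[OF that]] open_ball that])
         (use p(3) L(3) in simp)
    have "((\<lambda>z. z * (exp (L z) * deriv L z) + 1 * exp (L z)) has_field_derivative 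
       (0 * (exp (L 0) * deriv (deriv L) 0 + exp (L 0) * deriv L 0 * deriv L 0) + 1 * (exp (L 0) * deriv L 0)) 
          + (1 * (exp (L 0) * deriv L 0) + 0 * exp (L 0))) (at 0)"
      by (intro DERIV_add DERIV_mult' DERIV_ident DERIV_const eL L'') auto
    then show "((\<lambda>z. z * (exp (L z) * deriv L z) + 1 * exp (L z)) has_field_derivative 2 * deriv L 0) (at 0)"
      by (simp add: L(2))
  qed auto
  then have dL: "deriv L 0 = of_real (a / 2)" using a by simp
  (* With g z = z * exp (L z), the reciprocal of the square-root transform is V (z^2) / z. *)
  define V where "V = (\<lambda>x. exp (- (1/2) * L x))"
  have holV: "V holomorphic_on ball 0 1"
    unfolding V_def by (intro holomorphic_intros L)
  have V0: "V 0 = 1" by (simp add: V_def L)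
  have "(V has_field_derivative exp (- (1/2) * L 0) * (- (1/2) * deriv L 0)) (at 0)"
    unfolding V_def by (intro DERIV_chain2[OF DERIV_exp] DERIV_cmult L') auto
  then have V': "deriv V 0 = of_real (- a / 4)"
    using DERIV_imp_deriv by (fastforce simp: L dL)
  obtain V1 where V1: "V1 holomorphic_on ball 0 1" "V1 0 = of_real (- a / 4)" 
    "\<And>z. z \<in> ball 0 1 \<Longrightarrow> V z = 1 + z * V1 z"
    using disc_difference_quotient[OF holV] V0 V' by metis
  obtain V2 where V2: "V2 holomorphic_on ball 0 1" 
    "\<And>z. z \<in> ball 0 1 \<Longrightarrow> V1 z = of_real (- a / 4) + z * V2 z"
    using disc_difference_quotient[OF V1(1)] V1(2) by metis
  define h where "h = (\<lambda>z. z * exp (1/2 * L (z\<^sup>2)))"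
  define k where "k = (\<lambda>z. z * V2 (z\<^sup>2))"
  have sq: "z\<^sup>2 \<in> ball 0 1" if "z \<in> ball 0 1" for z :: complex
    using that by (simp add: norm_power power_less_one_iff)
  have comp: "(\<lambda>z. f (z\<^sup>2)) holomorphic_on ball 0 1" if "f holomorphic_on ball 0 1" for f
  proof -
    have "(\<lambda>z::complex. z\<^sup>2) ` ball 0 1 \<subseteq> ball 0 1" using sq by blast
    then show ?thesis
      using holomorphic_on_compose_gen[of "\<lambda>z. z\<^sup>2" "ball 0 1" f "ball 0 1"] that
      by (simp add: o_def holomorphic_on_power holomorphic_on_ident)
  qed
  have holh: "h holomorphic_on ball 0 1"
    unfolding h_def by (intro holomorphic_intros comp L)
  have holk: "k holomorphic_on ball 0 1"
    unfolding k_def by (intro holomorphic_intros comp V2)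
  have h2: "(h z)\<^sup>2 = g (z\<^sup>2)" if "z \<in> ball 0 1" for z
    using p(3)[OF sq[OF that]] L(3)[OF sq[OF that]]
    by (simp add: h_def power_mult_distrib exp_double[symmetric])
  have inj: "inj_on h (ball 0 1)"
  proof (rule inj_onI)
    fix x y assume xy: "x \<in> ball 0 1" "y \<in> ball 0 1" "h x = h y"
    then have "g (x\<^sup>2) = g (y\<^sup>2)" using h2 by metis
    then have "x\<^sup>2 = y\<^sup>2" using inj_onD[OF S(4)] sq xy by blast
    then have "x = y \<or> x = - y" by (simp add: power2_eq_iff)
    then show "x = y" using xy(3) by (auto simp: h_def)
  qed
  have "\<bar>- a / 4\<bar> \<le> 1"
  proof (rule area_theorem[OF holh inj _ holk])
    fix z :: complex assume z: "z \<in> ball 0 1 - {0}"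
    have "1 / h z = V (z\<^sup>2) / z"
      by (simp add: h_def V_def exp_minus field_simps)
    also have "V (z\<^sup>2) = 1 + z\<^sup>2 * (of_real (- a / 4) + z\<^sup>2 * V2 (z\<^sup>2))"
      using V1(3) V2(2) sq z by simp
    also have "\<dots> / z = 1 / z + of_real (- a / 4) * z + z\<^sup>2 * k z"
      using z by (simp add: k_def field_simps power2_eq_square)
    finally show "1 / h z = 1 / z + of_real (- a / 4) * z + z\<^sup>2 * k z" .
  qed (simp add: h_def)
  then show ?thesis by simp
qed

text \<open>Bieberbach's inequality: a rotation makes the second derivative at \<open>0\<close> real.\<close>
theorem second_coefficient_bound:
  assumes g: "g \<in> class_S"
  shows "norm (deriv (deriv g) 0) \<le> 4"
proof (cases "deriv (deriv g) 0 = 0")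
  case False
  define A where "A = deriv (deriv g) 0"
  define c where "c = cnj A / of_real (norm A)"
  define G where "G = (\<lambda>z. g (c * z) / c)"
  have c: "c \<noteq> 0" "norm c = 1" using False by (auto simp: c_def A_def norm_divide)
  note S = class_S_D[OF g]
  note d = disc_dilation_derivs[OF S(1), of c, folded G_def]
  have "inj_on G (ball 0 1)"
  proof (rule inj_onI)
    fix x y assume xy: "x \<in> ball 0 1" "y \<in> ball 0 1" "G x = G y"
    then have "g (c * x) = g (c * y)" "c * x \<in> ball 0 1" "c * y \<in> ball 0 1"
      using c by (simp_all add: G_def norm_mult)
    then have "c * x = c * y"
      by (rule inj_onD[OF S(4)])
    then show "x = y" using c by simp
  qed
  then have "G \<in> class_S"
    using d(1) d(2)[of 0] c S by (auto simp: class_S_def class_A_def G_def)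
  moreover have "deriv (deriv G) 0 = of_real (norm A)"
  proof -
    have "deriv (deriv G) 0 = c * A"
      using d(3)[of 0] c by (simp add: A_def)
    also have "\<dots> = of_real ((norm A)\<^sup>2) / of_real (norm A)"
      unfolding complex_norm_square by (simp add: c_def)
    finally show ?thesis by (simp add: power2_eq_square)
  qed
  ultimately show ?thesis
    using second_coefficient_real_bound[of G "norm A"] by (simp add: A_def)
qed auto

section \<open>Distortion bounds\<close>

lemma norm_cnj_mult_less_one: "norm z < 1 \<Longrightarrow> norm w < 1 \<Longrightarrow> norm (cnj z * w) < 1" for z w :: complex
  using mult_strict_mono[of "norm z" 1 "norm w" 1] by (cases "w = 0") (auto simp: norm_mult)

lemma disc_automorphism_derivs:
  assumes a: "norm a < 1" and z: "norm z < 1"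
  shows "(Moebius_function 0 (- a) has_field_derivative 
           of_real (1 - (norm a)\<^sup>2) / (1 + cnj a * z)\<^sup>2) (at z)"
    and "1 + cnj a * z \<noteq> 0"
proof -
  show nz: "1 + cnj a * z \<noteq> 0"
    using norm_cnj_mult_less_one[OF a z] by (metis add_eq_0_iff less_irrefl norm_minus_cancel norm_one)
  have aa: "a * cnj a = of_real ((norm a)\<^sup>2)"
    using complex_norm_square[of a] by simp
  have "((\<lambda>z. (z + a) / (1 + cnj a * z)) has_field_derivative
          ((1 + 0) * (1 + cnj a * z) - (z + a) * (0 + cnj a)) / ((1 + cnj a * z) * (1 + cnj a * z))) (at z)"
    by (intro DERIV_divide DERIV_add DERIV_ident DERIV_const DERIV_cmult_Id nz)
  moreover have "((1 + 0) * (1 + cnj a * z) - (z + a) * (0 + cnj a)) = of_real (1 - (norm a)\<^sup>2)"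
    using aa by (simp add: algebra_simps)
  moreover have "(\<lambda>z. (z + a) / (1 + cnj a * z)) = Moebius_function 0 (- a)"
    by (simp add: fun_eq_iff Moebius_function_simple)
  ultimately show "(Moebius_function 0 (- a) has_field_derivative 
           of_real (1 - (norm a)\<^sup>2) / (1 + cnj a * z)\<^sup>2) (at z)"
    by (simp only: power2_eq_square[of "1 + cnj a * z"])
qed

text \<open>
  The Koebe transform: precompose \<open>g\<close> with the disc automorphism \<open>\<phi>\<close> sending \<open>0\<close> to \<open>z\<close> and normalise. The
  second derivative at \<open>0\<close> of the resulting univalent function is the quantity on the left, so
  Bieberbach's inequality bounds it.
\<close>
lemma class_S_pre_schwarzian:
  assumes g: "g \<in> class_S" and z: "norm z < 1"
  shows "norm (of_real (1 - (norm z)\<^sup>2) * (deriv (deriv g) z / deriv g z) - 2 * cnj z) \<le> 4"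
proof -
  note S = class_S_D[OF g]
  define d where "d = 1 - (norm z)\<^sup>2"
  have d: "d > 0" using z by (simp add: d_def power_less_one_iff)
  have gz: "deriv g z \<noteq> 0" using S(5)[of z] z by simp
  define \<phi> where "\<phi> = Moebius_function 0 (- z)"
  define G where "G = (\<lambda>x. (g (\<phi> x) - g z) / (of_real d * deriv g z))"
  have \<phi>0: "\<phi> 0 = z" by (simp add: \<phi>_def Moebius_function_of_zero)
  have \<phi>_in: "\<phi> x \<in> ball 0 1" if "x \<in> ball 0 1" for x
    using Moebius_function_norm_lt_1[of "-z" x 0] z that by (simp add: \<phi>_def)
  have \<phi>': "(\<phi> has_field_derivative of_real d / (1 + cnj z * x)\<^sup>2) (at x)" "1 + cnj z * x \<noteq> 0" 
    if "x \<in> ball 0 1" for x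
    using disc_automorphism_derivs[OF z, of x] that by (simp_all add: \<phi>_def d_def)
  have comp: "((\<lambda>x. f (\<phi> x)) has_field_derivative deriv f (\<phi> x) * (of_real d / (1 + cnj z * x)\<^sup>2)) (at x)"
    if "f holomorphic_on ball 0 1" "x \<in> ball 0 1" for f x
    by (rule DERIV_chain2[OF holomorphic_derivI[OF that(1) open_ball \<phi>_in[OF that(2)]] \<phi>'(1)[OF that(2)]])
  have G': "(G has_field_derivative deriv g (\<phi> x) / (1 + cnj z * x)\<^sup>2 / deriv g z) (at x)"
    if "x \<in> ball 0 1" for x
  proof -
    have "(G has_field_derivative (deriv g (\<phi> x) * (of_real d / (1 + cnj z * x)\<^sup>2) - 0) / (of_real d * deriv g z)) (at x)"
      unfolding G_def by (intro DERIV_cdivide DERIV_diff comp[OF S(1) that] DERIV_const)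
    then show ?thesis using d by simp
  qed
  have "inj_on G (ball 0 1)"
  proof (rule inj_onI)
    fix x y assume xy: "x \<in> ball 0 1" "y \<in> ball 0 1" "G x = G y"
    then have "g (\<phi> x) = g (\<phi> y)" using d gz by (simp add: G_def)
    then have "\<phi> x = \<phi> y"
      by (rule inj_onD[OF S(4) _ \<phi>_in[OF xy(1)] \<phi>_in[OF xy(2)]])
    moreover have "Moebius_function 0 z (\<phi> u) = u" if "u \<in> ball 0 1" for u
      unfolding \<phi>_def by (rule Moebius_function_compose) (use z that in auto)
    ultimately show "x = y" using xy by metis
  qed
  moreover have "G holomorphic_on ball 0 1"
    using G' by (meson holomorphic_on_open open_ball)
  moreover have "deriv G 0 = 1"
    using DERIV_imp_deriv[OF G'[of 0]] gz by (simp add: \<phi>0)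
  ultimately have "G \<in> class_S"
    by (simp add: class_S_def class_A_def G_def \<phi>0)
  then have "norm (deriv (deriv G) 0) \<le> 4" by (rule second_coefficient_bound)
  moreover have "deriv (deriv G) 0 = of_real d * deriv (deriv g) z / deriv g z - 2 * cnj z"
  proof (rule deriv2_eqI[OF open_ball[of 0 1] _ G'])
    have 1: "((\<lambda>x. (1 + cnj z * x)\<^sup>2) has_field_derivative of_nat 2 * ((0 + cnj z) * (1 + cnj z * 0) ^ (2 - Suc 0))) (at 0)"
      by (intro DERIV_power DERIV_add DERIV_const DERIV_cmult_Id)
    have "((\<lambda>x. deriv g (\<phi> x) / (1 + cnj z * x)\<^sup>2 / deriv g z) has_field_derivative
       ((deriv (deriv g) (\<phi> 0) * (of_real d / (1 + cnj z * 0)\<^sup>2)) * (1 + cnj z * 0)\<^sup>2 - 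
         deriv g (\<phi> 0) * (of_nat 2 * ((0 + cnj z) * (1 + cnj z * 0) ^ (2 - Suc 0)))) 
           / ((1 + cnj z * 0)\<^sup>2 * (1 + cnj z * 0)\<^sup>2) / deriv g z) (at 0)"
      by (intro DERIV_cdivide DERIV_divide comp holomorphic_deriv S(1) 1) auto
    then show "((\<lambda>x. deriv g (\<phi> x) / (1 + cnj z * x)\<^sup>2 / deriv g z) has_field_derivative
       of_real d * deriv (deriv g) z / deriv g z - 2 * cnj z) (at 0)"
      using gz by (simp add: \<phi>0 diff_divide_distrib mult.commute)
  qed auto
  ultimately show ?thesis
    by (simp add: d_def)
qed

text \<open>
  Disc automorphisms moving \<open>z\<close> and \<open>w z\<close> to \<open>0\<close> reduce the inequality to the derivative bound in the
  Schwarz lemma.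
\<close>
lemma Schwarz_Pick_deriv:
  assumes holw: "w holomorphic_on ball 0 1" and w1: "\<And>z. z \<in> ball 0 1 \<Longrightarrow> norm (w z) < 1"
    and z: "norm z < 1"
  shows "norm (deriv w z) * (1 - (norm z)\<^sup>2) \<le> 1 - (norm (w z))\<^sup>2"
proof -
  define \<phi> where "\<phi> = Moebius_function 0 (- z)"
  define a where "a = w z"
  have a: "norm a < 1" using w1[of z] z by (simp add: a_def)
  have \<phi>0: "\<phi> 0 = z" by (simp add: \<phi>_def Moebius_function_of_zero)
  have \<phi>_in: "\<phi> x \<in> ball 0 1" if "x \<in> ball 0 1" for x
    using Moebius_function_norm_lt_1[of "-z" x 0] z that by (simp add: \<phi>_def)
  define W where "W = (\<lambda>x. Moebius_function 0 a (w (\<phi> x)))"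
  have M: "(Moebius_function 0 a has_field_derivative of_real (1 - (norm a)\<^sup>2) / (1 - cnj a * u)\<^sup>2) (at u)"
    if "norm u < 1" for u
    using disc_automorphism_derivs[of "- a" u] a that by simp
  have W': "(W has_field_derivative of_real (1 - (norm a)\<^sup>2) / (1 - cnj a * w (\<phi> x))\<^sup>2 *
       (deriv w (\<phi> x) * (of_real (1 - (norm z)\<^sup>2) / (1 + cnj z * x)\<^sup>2))) (at x)" if "x \<in> ball 0 1" for x
  proof -
    have "(\<phi> has_field_derivative of_real (1 - (norm z)\<^sup>2) / (1 + cnj z * x)\<^sup>2) (at x)"
      using disc_automorphism_derivs[OF z, of x] that by (simp add: \<phi>_def)
    with holomorphic_derivI[OF holw open_ball \<phi>_in[OF that]]
    have "((\<lambda>x. w (\<phi> x)) has_field_derivative deriv w (\<phi> x) * (of_real (1 - (norm z)\<^sup>2) / (1 + cnj z * x)\<^sup>2)) (at x)"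
      by (rule DERIV_chain2)
    with M[OF w1[OF \<phi>_in[OF that]]] show ?thesis
      unfolding W_def by (rule DERIV_chain2)
  qed
  have "norm (deriv W 0) \<le> 1"
  proof (rule Schwarz_Lemma(2)[of W 0])
    show "W holomorphic_on ball 0 1" using W' by (meson holomorphic_on_open open_ball)
    show "W 0 = 0" by (simp add: W_def \<phi>0 a_def Moebius_function_eq_zero)
    show "norm (W x) < 1" if "norm x < 1" for x
      unfolding W_def by (rule Moebius_function_norm_lt_1[OF a w1[OF \<phi>_in]]) (use that in auto)
  qed auto
  moreover have "deriv W 0 = of_real (1 - (norm a)\<^sup>2) / (1 - cnj a * a)\<^sup>2 * (deriv w z * of_real (1 - (norm z)\<^sup>2))"
    using DERIV_imp_deriv[OF W'[of 0]] by (simp add: \<phi>0 a_def)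
  moreover have "1 - cnj a * a = of_real (1 - (norm a)\<^sup>2)"
    using complex_norm_square[of a] by (simp add: mult.commute)
  moreover have pos: "1 - (norm a)\<^sup>2 > 0" "1 - (norm z)\<^sup>2 > 0" using a z by (simp_all add: power_less_one_iff)
  ultimately have "norm (of_real (1 - (norm a)\<^sup>2) / (of_real (1 - (norm a)\<^sup>2))\<^sup>2 * (deriv w z * of_real (1 - (norm z)\<^sup>2)) :: complex) \<le> 1"
    by metis
  then have "(1 - (norm a)\<^sup>2) / (1 - (norm a)\<^sup>2)\<^sup>2 * (norm (deriv w z) * (1 - (norm z)\<^sup>2)) \<le> 1"
    unfolding norm_mult norm_divide norm_power norm_of_real using pos by simp
  moreover have "x / x\<^sup>2 * y = y / x" if "x > 0" for x y :: real
    using that by (simp add: power2_eq_square)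
  ultimately have "norm (deriv w z) * (1 - (norm z)\<^sup>2) / (1 - (norm a)\<^sup>2) \<le> 1"
    using pos by metis
  then show ?thesis
    using pos by (simp add: a_def pos_divide_le_eq)
qed

text \<open>
  The factor \<open>g'\<close> contributes \<open>4\<close>. The factor \<open>1 + w\<close> contributes
  \<open>(1 - \<bar>z\<bar>\<^sup>2) \<bar>w'\<bar> / \<bar>1 + w\<bar> \<le> (1 - \<bar>w\<bar>\<^sup>2) / (1 - \<bar>w\<bar>) = 1 + \<bar>w\<bar> \<le> 1 + \<bar>z\<bar>\<close>, by the Schwarz-Pick lemma and the Schwarz lemma.
\<close>
lemma class_F6_pre_schwarzian:
  assumes f: "f \<in> class_F6" and z: "norm z < 1"
  shows "deriv f z \<noteq> 0"
    and "norm (of_real (1 - (norm z)\<^sup>2) * (deriv (deriv f) z / deriv f z) - 2 * cnj z) \<le> 5 + norm z"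
proof -
  obtain g where g: "g \<in> class_S" and gw: "\<And>z. z \<in> ball 0 1 \<Longrightarrow> norm (deriv f z / deriv g z - 1) < 1"
    and holf: "f holomorphic_on ball 0 1" and f0: "deriv f 0 = 1"
    using f by (auto simp: class_F6_def class_A_def)
  note S = class_S_D[OF g]
  define w where "w = (\<lambda>z. deriv f z / deriv g z - 1)"
  define d where "d = 1 - (norm z)\<^sup>2"
  have d: "d > 0" using z by (simp add: d_def power_less_one_iff)
  have zin: "z \<in> ball 0 1" using z by simp
  have w1: "norm (w z) < 1" if "z \<in> ball 0 1" for z using gw[OF that] by (simp add: w_def)
  have holw: "w holomorphic_on ball 0 1"
    unfolding w_def using S(5) by (intro holomorphic_intros holomorphic_deriv holf S(1)) auto
  have w0: "w 0 = 0" using S(3) f0 by (simp add: w_def)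
  have f': "deriv f x = deriv g x * (1 + w x)" if "x \<in> ball 0 1" for x
    using S(5)[OF that] by (simp add: w_def)
  have nz: "1 + w z \<noteq> 0"
    using w1[OF zin] by (metis add_eq_0_iff less_irrefl norm_minus_cancel norm_one)
  then show f'z: "deriv f z \<noteq> 0"
    using f'[OF zin] S(5)[OF zin] by simp
  have hd: "(u has_field_derivative deriv u z) (at z)" if "u holomorphic_on ball 0 1" for u
    by (rule holomorphic_derivI[OF that open_ball zin])
  have "((\<lambda>x. deriv g x * (1 + w x)) has_field_derivative 
          (deriv g z * (0 + deriv w z) + deriv (deriv g) z * (1 + w z))) (at z)"
    by (intro DERIV_mult' DERIV_add DERIV_const hd holw holomorphic_deriv S(1) open_ball)
  then have "(deriv f has_field_derivative 
          (deriv g z * (0 + deriv w z) + deriv (deriv g) z * (1 + w z))) (at z)"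
    by (rule has_field_derivative_transform_within_open[OF _ open_ball zin]) (simp add: f')
  then have "deriv (deriv f) z = deriv g z * deriv w z + deriv (deriv g) z * (1 + w z)"
    by (simp add: DERIV_imp_deriv)
  then have q: "deriv (deriv f) z / deriv f z = deriv (deriv g) z / deriv g z + deriv w z / (1 + w z)"
    unfolding f'[OF zin] using nz S(5)[OF zin] by (simp add: add_divide_distrib)
  have w_le: "norm (w z) \<le> norm z"
    by (rule Schwarz_Lemma(1)[OF holw w0 _ z]) (use w1 in auto)
  have "norm (of_real d * (deriv w z / (1 + w z))) = norm (deriv w z) * d / norm (1 + w z)"
    using d by (simp add: norm_mult norm_divide)
  also have "\<dots> \<le> (1 - (norm (w z))\<^sup>2) / norm (1 + w z)"
    using Schwarz_Pick_deriv[OF holw w1 z] by (intro divide_right_mono) (auto simp: d_def)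
  also have "\<dots> \<le> (1 - (norm (w z))\<^sup>2) / (1 - norm (w z))"
  proof (rule divide_left_mono)
    show "1 - norm (w z) \<le> norm (1 + w z)"
      using norm_triangle_ineq2[of 1 "- w z"] by simp
    show "0 \<le> 1 - (norm (w z))\<^sup>2"
      using w1[OF zin] by (simp add: power_le_one)
    show "0 < norm (1 + w z) * (1 - norm (w z))"
      using nz w1[OF zin] by simp
  qed
  also have "\<dots> = 1 + norm (w z)"
    using w1[OF zin] by (simp add: field_simps power2_eq_square)
  also have "\<dots> \<le> 1 + norm z" using w_le by simp
  finally have ww: "norm (of_real d * (deriv w z / (1 + w z))) \<le> 1 + norm z" .
  have "of_real d * (deriv (deriv f) z / deriv f z) - 2 * cnj z =
     (of_real d * (deriv (deriv g) z / deriv g z) - 2 * cnj z) + of_real d * (deriv w z / (1 + w z))"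
    unfolding q by (simp only: distrib_left add_diff_eq diff_add_eq)
  also have "norm \<dots> \<le> 4 + (1 + norm z)"
    by (rule norm_triangle_mono[OF class_S_pre_schwarzian[OF g z, folded d_def] ww])
  finally show "norm (of_real (1 - (norm z)\<^sup>2) * (deriv (deriv f) z / deriv f z) - 2 * cnj z) \<le> 5 + norm z"
    by (simp add: d_def)
qed

text \<open>The preceding bound multiplied by \<open>z / (1 - \<bar>z\<bar>\<^sup>2)\<close>.\<close>
lemma class_F6_convexity_disc:
  assumes f: "f \<in> class_F6" and z: "norm z < 1"
  defines "u \<equiv> norm z" and "q \<equiv> z * deriv (deriv f) z / deriv f z"
  shows "norm (q - of_real (2 * u\<^sup>2 / (1 - u\<^sup>2))) \<le> (5 * u + u\<^sup>2) / (1 - u\<^sup>2)"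
    and "(1 - 5 * u) / (1 - u\<^sup>2) \<le> Re (1 + q)"
proof -
  define d where "d = 1 - u\<^sup>2"
  have d: "d > 0" using z by (simp add: d_def u_def power_less_one_iff)
  define p where "p = deriv (deriv f) z / deriv f z"
  have zz: "z * cnj z = of_real (u\<^sup>2)"
    using complex_norm_square[of z] by (simp add: u_def)
  have "q - of_real (2 * u\<^sup>2 / d) = (z / of_real d) * (of_real d * p - 2 * cnj z)"
  proof -
    have "(z / of_real d) * (of_real d * p - 2 * cnj z) = q - 2 * (z * cnj z) / of_real d"
      using d by (simp add: right_diff_distrib q_def p_def)
    then show ?thesis unfolding zz by simp
  qed
  then have "norm (q - of_real (2 * u\<^sup>2 / d)) = u / d * norm (of_real d * p - 2 * cnj z)"
    using d by (simp add: norm_mult norm_divide u_def)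
  also have "\<dots> \<le> u / d * (5 + u)"
    using d class_F6_pre_schwarzian(2)[OF f z] 
    by (intro mult_left_mono) (simp_all add: u_def d_def p_def)
  also have "\<dots> = (5 * u + u\<^sup>2) / d" by (simp add: algebra_simps power2_eq_square add_divide_distrib)
  finally have main: "norm (q - of_real (2 * u\<^sup>2 / d)) \<le> (5 * u + u\<^sup>2) / d" .
  then show "norm (q - of_real (2 * u\<^sup>2 / (1 - u\<^sup>2))) \<le> (5 * u + u\<^sup>2) / (1 - u\<^sup>2)"
    by (simp add: d_def)
  have "\<bar>Re q - 2 * u\<^sup>2 / d\<bar> \<le> (5 * u + u\<^sup>2) / d"
    using order_trans[OF abs_Re_le_cmod main] by simp
  then have "1 + 2 * u\<^sup>2 / d - (5 * u + u\<^sup>2) / d \<le> Re (1 + q)" by simp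
  moreover have "1 + 2 * u\<^sup>2 / d - (5 * u + u\<^sup>2) / d = (1 - 5 * u) / d"
  proof -
    have "1 + A / d - B / d = (d + A - B) / d" for A B
      using d by (simp add: add_divide_distrib diff_divide_distrib)
    then show ?thesis by (simp add: d_def)
  qed
  ultimately show "(1 - 5 * u) / (1 - u\<^sup>2) \<le> Re (1 + q)" by (simp add: d_def)
qed

section \<open>Univalence near the origin\<close>

text \<open>
  The criterion of Noshiro and Warschawski: along the segment from \<open>x\<close> to \<open>y\<close>, the real part of
  \<open>f / (y - x)\<close> has derivative \<open>Re f'\<close> and so is strictly increasing.
\<close>

lemma inj_on_if_Re_deriv_pos:
  assumes holf: "f holomorphic_on S" and S: "open S" "convex S"
    and pos: "\<And>z. z \<in> S \<Longrightarrow> Re (deriv f z) > 0"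
  shows "inj_on f S"
proof (rule inj_onI, rule ccontr)
  fix x y assume xy: "x \<in> S" "y \<in> S" "f x = f y" "x \<noteq> y"
  define l where "l = (\<lambda>t::real. x + of_real t * (y - x))"
  have l: "l t \<in> S" if "0 \<le> t" "t \<le> 1" for t
    using convexD[OF S(2) xy(1,2), of "1 - t" t] that
    by (simp add: l_def scaleR_conv_of_real algebra_simps)
  have der: "((\<lambda>t. Re (f (l t) / (y - x))) has_real_derivative Re (deriv f (l t))) (at t)"
    if t: "0 \<le> t" "t \<le> 1" for t
  proof -
    have "(l has_vector_derivative (y - x)) (at t)"
      unfolding l_def by (auto intro!: derivative_eq_intros simp: has_vector_derivative_def scaleR_conv_of_real)
    moreover have "(f has_field_derivative deriv f (l t)) (at (l t))"
      by (rule holomorphic_derivI[OF holf S(1) l[OF t]])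
    ultimately have "((f \<circ> l) has_vector_derivative (y - x) * deriv f (l t)) (at t)"
      by (rule field_vector_diff_chain_at)
    then have "((\<lambda>t. f (l t) / (y - x)) has_vector_derivative (y - x) * deriv f (l t) / (y - x)) (at t)"
      unfolding o_def by (rule has_vector_derivative_divide)
    from bounded_linear.has_vector_derivative[OF bounded_linear_Re this]
    have "((\<lambda>t. Re (f (l t) / (y - x))) has_vector_derivative Re (deriv f (l t))) (at t)"
      using xy(4) by simp
    then show ?thesis by (simp add: has_real_derivative_iff_has_vector_derivative)
  qed
  have "Re (f (l 0) / (y - x)) < Re (f (l 1) / (y - x))"
    by (rule DERIV_pos_imp_increasing[OF zero_less_one]) (use der pos l in blast)
  then show False using xy(3) by (simp add: l_def)
qed

text \<open>
  For \<open>\<bar>z\<bar> < 1/5\<close> the distortion bound gives \<open>\<bar>f''/f'\<bar> \<le> (5 + 3/5) / (1 - 1/25) < 6\<close>. Hence \<open>\<bar>log f'\<bar> \<le> 6/5 < \<pi>/2\<close>,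
  and \<open>f'\<close> has positive real part. The number \<open>1/5\<close> is the radius for \<open>class_C 0\<close>, the largest that occurs.
\<close>
lemma class_F6_inj_on:
  assumes f: "f \<in> class_F6"
  shows "inj_on f (ball 0 (1/5))"
proof -
  have holf: "f holomorphic_on ball 0 1" and f0: "deriv f 0 = 1"
    using f by (auto simp: class_F6_def class_A_def)
  have nz: "deriv f z \<noteq> 0" if "z \<in> ball 0 1" for z
    using class_F6_pre_schwarzian(1)[OF f, of z] that by simp
  have sub: "ball 0 (1/5) \<subseteq> ball (0::complex) 1" by auto
  obtain h where h: "h holomorphic_on ball 0 1" "h 0 = 0" "\<And>z. z \<in> ball 0 1 \<Longrightarrow> deriv f z = exp (h z)"
    and h': "\<And>z. z \<in> ball 0 1 \<Longrightarrow> deriv h z = deriv (deriv f) z / deriv f z"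
    using disc_holomorphic_log[OF holomorphic_deriv[OF holf open_ball] nz f0] by metis
  have h'6: "norm (deriv h z) \<le> 6" if z: "z \<in> ball 0 (1/5)" for z
  proof -
    define u where "u = norm z"
    define d where "d = 1 - u\<^sup>2"
    have u: "0 \<le> u" "u < 1/5" using z by (auto simp: u_def)
    have zin: "z \<in> ball 0 1" using z sub by blast
    have "u\<^sup>2 < 1 / 25" using u power_strict_mono[of u "1/5" 2] by (simp add: power2_eq_square)
    then have d: "d > 24/25" by (simp add: d_def)
    have "norm (of_real d * deriv h z - 2 * cnj z) \<le> 5 + u"
      using class_F6_pre_schwarzian(2)[OF f, of z] zin by (simp add: h' d_def u_def)
    moreover have "norm (of_real d * deriv h z) \<le> norm (of_real d * deriv h z - 2 * cnj z) + norm (2 * cnj z)"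
      using norm_triangle_ineq[of "of_real d * deriv h z - 2 * cnj z" "2 * cnj z"] by simp
    ultimately have "d * norm (deriv h z) \<le> 5 + 3 * u"
      using d by (simp add: norm_mult u_def)
    also have "\<dots> \<le> 24/25 * 6" using u by simp
    also have "\<dots> \<le> d * 6" using d by simp
    finally show ?thesis using d by simp
  qed
  show ?thesis
  proof (rule inj_on_if_Re_deriv_pos[OF holomorphic_on_subset[OF holf sub] open_ball convex_ball])
    fix z :: complex assume z: "z \<in> ball 0 (1/5)"
    have "norm (h z - h 0) \<le> 6 * norm (z - 0)"
    proof (rule field_differentiable_bound[of "ball 0 (1/5)" h "deriv h"])
      show "(h has_field_derivative deriv h x) (at x within ball 0 (1/5))" if "x \<in> ball 0 (1/5)" for x
        using holomorphic_derivI[OF h(1) open_ball] sub that by blast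
    qed (use h'6 z in auto)
    then have "norm (h z) \<le> 6 / 5" using z h(2) by simp
    then have "\<bar>Im (h z)\<bar> \<le> 6 / 5" using abs_Im_le_cmod order_trans by blast
    then have "cos (Im (h z)) > 0" using pi_gt3 by (intro cos_gt_zero_pi) auto
    then show "Re (deriv f z) > 0"
      using h(3)[of z] sub z by (auto simp: Re_exp)
  qed
qed

lemma disc_dilation_pre_schwarzian:
  assumes "f holomorphic_on ball 0 1" and "c \<noteq> 0" "norm c \<le> 1" "z \<in> ball 0 1"
  defines "F \<equiv> \<lambda>z. f (c * z) / c"
  shows "z * deriv (deriv F) z / deriv F z = (c * z) * deriv (deriv f) (c * z) / deriv f (c * z)"
  unfolding F_def disc_dilation_derivs(2,3)[OF assms(1-4)] by (simp only: mult_ac)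

lemma class_F6_dilation_univalent:
  assumes f: "f \<in> class_F6" and r: "0 < r" "r \<le> 1/5"
  defines "F \<equiv> \<lambda>z. f (of_real r * z) / of_real r"
  shows "F \<in> class_S"
proof -
  have holf: "f holomorphic_on ball 0 1" and f0: "f 0 = 0" "deriv f 0 = 1"
    using f by (auto simp: class_F6_def class_A_def)
  note d = disc_dilation_derivs[OF holf, of "of_real r", folded F_def]
  have "inj_on F (ball 0 1)"
  proof (rule inj_onI)
    fix x y assume xy: "x \<in> ball 0 1" "y \<in> ball 0 1" "F x = F y"
    have in5: "of_real r * v \<in> ball 0 (1/5)" if "v \<in> ball 0 1" for v :: complex
      using that r mult_less_le_imp_less[of "norm v" 1 r "1/5"] by (simp add: norm_mult mult.commute)
    have "f (of_real r * x) = f (of_real r * y)"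
      using xy(3) r by (simp add: F_def)
    then have "complex_of_real r * x = of_real r * y"
      by (rule inj_onD[OF class_F6_inj_on[OF f] _ in5[OF xy(1)] in5[OF xy(2)]])
    then show "x = y" using r by simp
  qed
  then show "F \<in> class_S"
    using d(1) d(2)[of 0] f0 r by (simp add: class_S_def class_A_def F_def)
qed

section \<open>The extremal function\<close>

lemma koebe_in_class_S:
  defines "k \<equiv> \<lambda>z::complex. z / (1 - z)\<^sup>2"
  shows "k \<in> class_S" and "z \<in> ball 0 1 \<Longrightarrow> deriv k z = (1 + z) / (1 - z) ^ 3"
proof -
  have nz: "1 - z \<noteq> 0" if "z \<in> ball 0 1" for z :: complex using that by auto
  have k': "(k has_field_derivative (1 + z) / (1 - z) ^ 3) (at z)" if "z \<in> ball 0 1" for z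
  proof -
    have "((\<lambda>z. (1 - z)\<^sup>2) has_field_derivative of_nat 2 * ((0 - 1) * (1 - z) ^ (2 - Suc 0))) (at z)"
      by (intro DERIV_power DERIV_diff DERIV_const DERIV_ident)
    from DERIV_divide[OF DERIV_ident this]
    have "(k has_field_derivative (1 * (1 - z)\<^sup>2 - z * (of_nat 2 * ((0 - 1) * (1 - z) ^ (2 - Suc 0)))) / ((1 - z)\<^sup>2 * (1 - z)\<^sup>2)) (at z)"
      unfolding k_def using nz[OF that] by simp
    moreover have "(1 * (1 - z)\<^sup>2 - z * (of_nat 2 * ((0 - 1) * (1 - z) ^ (2 - Suc 0)))) / ((1 - z)\<^sup>2 * (1 - z)\<^sup>2) = (1 + z) / (1 - z) ^ 3"
    proof -
      have v: "(1 * v\<^sup>2 - z * (of_nat 2 * ((0 - 1) * v ^ (2 - Suc 0)))) / (v\<^sup>2 * v\<^sup>2) = (v + 2 * z) / v ^ 3" if "v \<noteq> 0" for v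
        using that by (simp add: divide_simps) (simp add: eval_nat_numeral algebra_simps)
      have "1 - z + 2 * z = 1 + z" by simp
      with v[OF nz[OF that]] show ?thesis by (simp only:)
    qed
    ultimately show ?thesis by simp
  qed
  show "z \<in> ball 0 1 \<Longrightarrow> deriv k z = (1 + z) / (1 - z) ^ 3"
    by (rule DERIV_imp_deriv[OF k'])
  have "inj_on k (ball 0 1)"
  proof (rule inj_onI)
    fix x y :: complex assume xy: "x \<in> ball 0 1" "y \<in> ball 0 1" "k x = k y"
    then have "x * (1 - y)\<^sup>2 = y * (1 - x)\<^sup>2"
      using nz by (simp add: k_def frac_eq_eq)
    then have "(x - y) * (1 - x * y) = 0"
      by (simp add: power2_eq_square algebra_simps)
    moreover have "x * y \<noteq> 1"
      using norm_cnj_mult_less_one[of "cnj x" y] xy by auto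
    ultimately show "x = y" by simp
  qed
  moreover have "k holomorphic_on ball 0 1"
    using k' by (meson holomorphic_on_open open_ball)
  ultimately show "k \<in> class_S"
    using DERIV_imp_deriv[OF k'[of 0]] by (simp add: class_S_def class_A_def k_def)
qed

text \<open>
  The choice \<open>g z = z / (1 - z)\<^sup>2\<close> and \<open>w z = z\<close> gives \<open>f' = (1 + z)\<^sup>2 / (1 - z)\<^sup>3\<close>. At \<open>z = - u\<close> both
  summands of \<open>z f''/f'\<close> attain their least possible real part.
\<close>
lemma class_F6_extremal:
  obtains f where "f \<in> class_F6"
    "\<And>u. 0 < u \<Longrightarrow> u < 1 \<Longrightarrow> - of_real u * deriv (deriv f) (- of_real u) / deriv f (- of_real u) =
             complex_of_real ((u\<^sup>2 - 5 * u) / (1 - u\<^sup>2))"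
proof -
  define E where "E = (\<lambda>z::complex. (1 + z)\<^sup>2 / (1 - z) ^ 3)"
  have nz: "1 - z \<noteq> 0" "1 + z \<noteq> 0" if "z \<in> ball 0 1" for z :: complex
    using that by (auto simp: add_eq_0_iff)
  have holE: "E holomorphic_on ball 0 1"
    unfolding E_def using nz by (intro holomorphic_intros) auto
  obtain f where f: "\<And>z. z \<in> ball 0 1 \<Longrightarrow> (f has_field_derivative E z) (at z)"
    using holomorphic_convex_primitive'[OF convex_ball open_ball holE] at_within_open[OF _ open_ball] by metis
  define F where "F = (\<lambda>z. f z - f 0)"
  have F: "(F has_field_derivative E z) (at z)" if "z \<in> ball 0 1" for z
    using DERIV_diff[OF f[OF that] DERIV_const[of "f 0"]] by (simp add: F_def)
  have F': "deriv F z = E z" if "z \<in> ball 0 1" for z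
    by (rule DERIV_imp_deriv[OF F[OF that]])
  have "F holomorphic_on ball 0 1"
    using F by (meson holomorphic_on_open open_ball)
  then have "F \<in> class_A"
    using F'[of 0] by (simp add: class_A_def F_def E_def)
  moreover have "norm (deriv F z / deriv (\<lambda>z. z / (1 - z)\<^sup>2) z - 1) < 1" if "z \<in> ball 0 1" for z
  proof -
    have "deriv F z / deriv (\<lambda>z. z / (1 - z)\<^sup>2) z = 1 + z"
      unfolding F'[OF that] koebe_in_class_S(2)[OF that] E_def
      using nz[OF that] by (simp add: power2_eq_square)
    then show ?thesis using that by simp
  qed
  ultimately have "F \<in> class_F6"
    unfolding class_F6_def by (intro CollectI conjI bexI[OF _ koebe_in_class_S(1)] ballI)
  moreover have "- of_real u * deriv (deriv F) (- of_real u) / deriv F (- of_real u) =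
             complex_of_real ((u\<^sup>2 - 5 * u) / (1 - u\<^sup>2))" if u: "0 < u" "u < 1" for u
  proof -
    define z :: complex where "z = - of_real u"
    have z: "z \<in> ball 0 1" using u by (simp add: z_def)
    define a where "a = 1 + z"
    define b where "b = 1 - z"
    have ab: "a \<noteq> 0" "b \<noteq> 0" using nz[OF z] by (auto simp: a_def b_def)
    have "(E has_field_derivative ((of_nat 2 * ((0 + 1) * a ^ (2 - Suc 0))) * b ^ 3 - 
            a\<^sup>2 * (of_nat 3 * ((0 - 1) * b ^ (3 - Suc 0)))) / (b ^ 3 * b ^ 3)) (at z)"
      unfolding E_def a_def b_def using nz[OF z]
      by (intro DERIV_divide DERIV_power DERIV_add DERIV_diff DERIV_const DERIV_ident) auto
    from deriv2_eqI[OF open_ball z F this] 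
    have "deriv (deriv F) z = ((of_nat 2 * ((0 + 1) * a ^ (2 - Suc 0))) * b ^ 3 - 
            a\<^sup>2 * (of_nat 3 * ((0 - 1) * b ^ (3 - Suc 0)))) / (b ^ 3 * b ^ 3)"
      .
    also have "\<dots> = (a\<^sup>2 / b ^ 3) * (2 / a + 3 / b)"
      using ab by (simp add: divide_simps) (simp add: eval_nat_numeral algebra_simps)
    finally have "z * deriv (deriv F) z / deriv F z = z * (2 / a + 3 / b)"
      using ab by (simp add: F'[OF z] E_def a_def[symmetric] b_def[symmetric])
    also have "\<dots> = of_real (- u * (2 / (1 - u) + 3 / (1 + u)))"
      by (simp add: a_def b_def z_def)
    also have "- u * (2 / (1 - u) + 3 / (1 + u)) = (u\<^sup>2 - 5 * u) / ((1 - u) * (1 + u))"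
      using u by (simp add: divide_simps) (simp add: power2_eq_square algebra_simps)
    also have "(1 - u) * (1 + u) = 1 - u\<^sup>2" by (simp add: power2_eq_square algebra_simps)
    finally show ?thesis by (simp add: z_def)
  qed
  ultimately show thesis by (rule that)
qed

lemma class_F6_extremal_dilation:
  assumes u: "0 < u" "u < r" and r: "r \<le> 1"
  obtains f z where "f \<in> class_F6" "z \<in> ball 0 1"
    "z * deriv (deriv (\<lambda>z. f (of_real r * z) / of_real r)) z / deriv (\<lambda>z. f (of_real r * z) / of_real r) z =
       complex_of_real ((u\<^sup>2 - 5 * u) / (1 - u\<^sup>2))"
proof -
  obtain f where f: "f \<in> class_F6" and ext: "- of_real u * deriv (deriv f) (- of_real u) / deriv f (- of_real u) =
           complex_of_real ((u\<^sup>2 - 5 * u) / (1 - u\<^sup>2))"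
    using class_F6_extremal u r by (metis less_le_trans)
  have holf: "f holomorphic_on ball 0 1" using f by (simp add: class_F6_def class_A_def)
  define z where "z = - complex_of_real (u / r)"
  have z: "z \<in> ball 0 1" "of_real r * z = - of_real u"
    using u r by (simp_all add: z_def norm_divide)
  show thesis
    using disc_dilation_pre_schwarzian[OF holf _ _ z(1), of "of_real r"] u r
    by (intro that[OF f z(1)]) (simp add: z(2) ext[simplified])
qed

section \<open>The radius of convexity of a given order\<close>

text \<open>
  Clearing the denominator turns the condition into positivity of \<open>\<alpha> u\<^sup>2 - 5 u + (1 - \<alpha>)\<close>. The number \<open>R\<close>
  is its smaller root, written so as to make sense for \<open>\<alpha> = 0\<close> as well; for \<open>\<alpha> > 0\<close> the other root exceeds \<open>1\<close>.
\<close>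

lemma convexity_radius_quadratic:
  fixes \<alpha> :: real
  assumes \<alpha>: "0 \<le> \<alpha>" "\<alpha> < 1"
  defines "R \<equiv> 2 * (1 - \<alpha>) / (5 + sqrt (25 + 4 * \<alpha> * (\<alpha> - 1)))"
  shows "0 < R" "R \<le> 1/5"
    and "\<And>u. 0 \<le> u \<Longrightarrow> u < 1 \<Longrightarrow> \<alpha> < (1 - 5 * u) / (1 - u\<^sup>2) \<longleftrightarrow> u < R"
    and "\<And>u. 0 \<le> u \<Longrightarrow> u < 1 \<Longrightarrow> \<alpha> \<le> (1 - 5 * u) / (1 - u\<^sup>2) \<longleftrightarrow> u \<le> R"
proof -
  define s where "s = sqrt (25 + 4 * \<alpha> * (\<alpha> - 1))"
  define P where "P = (\<lambda>u. \<alpha> * u\<^sup>2 - 5 * u + (1 - \<alpha>))"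
  have "\<alpha> * (1 - \<alpha>) \<le> 1 * 1"
    using \<alpha> by (intro mult_mono) auto
  then have s2: "s\<^sup>2 = 25 - 4 * \<alpha> * (1 - \<alpha>)" and s0: "s \<ge> 0"
    by (simp_all add: s_def algebra_simps)
  have Rs: "R * (5 + s) = 2 * (1 - \<alpha>)" and R0: "0 < R"
    using \<alpha> s0 by (simp_all add: R_def s_def[symmetric] add_pos_nonneg)
  then show "0 < R" by simp
  have "R * 5 \<le> R * (5 + s)" using R0 s0 by (intro mult_left_mono) auto
  then have R25: "R \<le> 2/5" using Rs \<alpha> by simp
  have "P R * (5 + s)\<^sup>2 = \<alpha> * (R * (5 + s))\<^sup>2 - 5 * (R * (5 + s)) * (5 + s) + (1 - \<alpha>) * (5 + s)\<^sup>2"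
    by (simp add: P_def power2_eq_square algebra_simps)
  also have "\<dots> = (1 - \<alpha>) * (4 * \<alpha> * (1 - \<alpha>) - 25 + s\<^sup>2)"
    unfolding Rs by (simp add: power2_eq_square algebra_simps)
  also have "\<dots> = 0" unfolding s2 by simp
  finally have PR: "P R = 0" using s0 by auto
  have P: "P u = (R - u) * (5 - \<alpha> * (R + u))" for u
  proof -
    have "P u = P u - P R" using PR by simp
    then show ?thesis by (simp add: P_def power2_eq_square algebra_simps)
  qed
  have fac: "5 - \<alpha> * (R + u) > 0" if "0 \<le> u" "u < 1" for u
  proof -
    have "\<alpha> * (R + u) \<le> 1 * (2/5 + 1)" using \<alpha> R0 R25 that by (intro mult_mono) auto
    then show ?thesis by simp
  qed
  have "P (1/5) \<le> 0" using \<alpha> by (simp add: P_def power2_eq_square)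
  then show "R \<le> 1/5" using P[of "1/5"] fac[of "1/5"] by (simp add: mult_le_0_iff)
  fix u :: real assume u: "0 \<le> u" "u < 1"
  have d: "1 - u\<^sup>2 > 0" using u by (simp add: power_less_one_iff)
  have "\<alpha> < (1 - 5 * u) / (1 - u\<^sup>2) \<longleftrightarrow> 0 < P u"
    using d by (simp add: pos_less_divide_eq P_def algebra_simps)
  also have "\<dots> \<longleftrightarrow> u < R"
    unfolding P using fac[OF u] by (simp add: zero_less_mult_iff)
  finally show "\<alpha> < (1 - 5 * u) / (1 - u\<^sup>2) \<longleftrightarrow> u < R" .
  have "\<alpha> \<le> (1 - 5 * u) / (1 - u\<^sup>2) \<longleftrightarrow> 0 \<le> P u"
    using d by (simp add: pos_le_divide_eq P_def algebra_simps)
  also have "\<dots> \<longleftrightarrow> u \<le> R"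
    unfolding P using fac[OF u] by (simp add: zero_le_mult_iff)
  finally show "\<alpha> \<le> (1 - 5 * u) / (1 - u\<^sup>2) \<longleftrightarrow> u \<le> R" .
qed

lemma convexity_radius_half:
  "2 * (1 - 1/2) / (5 + sqrt (25 + 4 * (1/2) * (1/2 - 1))) = 5 - 2 * sqrt (6::real)"
proof -
  have "sqrt 24 = sqrt (2\<^sup>2 * 6 :: real)" by simp
  also have "\<dots> = 2 * sqrt 6" unfolding real_sqrt_mult by simp
  finally have 1: "sqrt (25 + 4 * (1/2) * (1/2 - 1)) = 2 * sqrt (6::real)" by simp
  have "(5 - 2 * sqrt 6) * (5 + 2 * sqrt 6) = (1::real)" by (simp add: algebra_simps)
  moreover have "5 + 2 * sqrt 6 > (0::real)" by (simp add: add_pos_nonneg)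
  ultimately show ?thesis unfolding 1 by (simp add: divide_eq_eq)
qed

theorem class_C_radius_of_class_F6:
  assumes \<alpha>: "0 \<le> \<alpha>" "\<alpha> < 1"
  shows "is_radius (class_C \<alpha>) class_F6 (2 * (1 - \<alpha>) / (5 + sqrt (25 + 4 * \<alpha> * (\<alpha> - 1))))"
proof -
  define R where "R = 2 * (1 - \<alpha>) / (5 + sqrt (25 + 4 * \<alpha> * (\<alpha> - 1)))"
  note quad = convexity_radius_quadratic[OF \<alpha>, folded R_def]
  have "radius_property (class_C \<alpha>) class_F6 R"
    unfolding radius_property_def
  proof (intro conjI allI impI)
    fix r f assume "0 < r \<and> r \<le> R \<and> f \<in> class_F6"
    then have r: "0 < r" "r \<le> R" "r \<le> 1/5" and f: "f \<in> class_F6"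
      using quad(2) by auto
    define F where "F = (\<lambda>z. f (of_real r * z) / of_real r)"
    have holf: "f holomorphic_on ball 0 1" using f by (simp add: class_F6_def class_A_def)
    have "Re (1 + z * deriv (deriv F) z / deriv F z) > \<alpha>" if z: "z \<in> ball 0 1" for z
    proof -
      define x where "x = of_real r * z"
      have "r * norm z < r * 1" using r z by (intro mult_strict_left_mono) auto
      then have "norm x < r" using r(1) by (simp add: x_def norm_mult)
      then have x: "norm x < R" "norm x < 1" using r by simp_all
      have "\<alpha> < (1 - 5 * norm x) / (1 - (norm x)\<^sup>2)"
        using quad(3)[of "norm x"] x by simp
      also have "\<dots> \<le> Re (1 + x * deriv (deriv f) x / deriv f x)"
        by (rule class_F6_convexity_disc(2)[OF f x(2)])
      finally show ?thesis
        unfolding F_def x_def using disc_dilation_pre_schwarzian[OF holf _ _ z, of "of_real r"] r by simp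
    qed
    then show "(\<lambda>z. f (of_real r * z) / of_real r) \<in> class_C \<alpha>"
      using class_F6_dilation_univalent[OF f r(1,3)] by (simp add: class_C_def F_def)
  qed (use quad in auto)
  moreover have "R' \<le> R" if R': "radius_property (class_C \<alpha>) class_F6 R'" for R'
  proof (rule ccontr)
    assume "\<not> R' \<le> R"
    then have r: "R < R'" "R' \<le> 1" "0 < R'" using R' quad(1) by (auto simp: radius_property_def)
    obtain u where u: "R < u" "u < R'" using dense[OF r(1)] by blast
    then have u1: "0 < u" "u < 1" using r quad(1) by auto
    obtain f z where f: "f \<in> class_F6" and z: "z \<in> ball 0 1"
      and ext: "z * deriv (deriv (\<lambda>z. f (of_real R' * z) / of_real R')) z / deriv (\<lambda>z. f (of_real R' * z) / of_real R') z =
         complex_of_real ((u\<^sup>2 - 5 * u) / (1 - u\<^sup>2))"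
      using class_F6_extremal_dilation[OF u1(1) u(2) r(2)] by blast
    define F where "F = (\<lambda>z. f (of_real R' * z) / of_real R')"
    have "F \<in> class_C \<alpha>"
      using R' f r by (simp add: radius_property_def F_def)
    then have 1: "Re (1 + z * deriv (deriv F) z / deriv F z) > \<alpha>"
      using z by (simp add: class_C_def)
    have "z * deriv (deriv F) z / deriv F z = of_real ((u\<^sup>2 - 5 * u) / (1 - u\<^sup>2))"
      using ext by (simp only: F_def)
    then have "Re (1 + z * deriv (deriv F) z / deriv F z) = 1 + (u\<^sup>2 - 5 * u) / (1 - u\<^sup>2)"
      by (simp only: plus_complex.sel one_complex.sel Re_complex_of_real)
    also have "\<dots> = (1 - 5 * u) / (1 - u\<^sup>2)"
    proof -
      have "1 - u\<^sup>2 > 0" using u1 by (simp add: power_less_one_iff)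
      then show ?thesis by (simp add: divide_simps)
    qed
    finally show False
      using 1 quad(3)[of u] u u1 by simp
  qed
  ultimately show ?thesis by (simp add: is_radius_def R_def)
qed

section \<open>Uniform convexity\<close>

text \<open>
  The tangent of the image arc is \<open>i \<rho> exp (i t) F'\<close>, and \<open>F' = exp h\<close>. Thus \<open>Im h + t + \<pi>/2\<close> is a
  smooth branch of its argument.
\<close>

lemma circular_arc_tangent:
  fixes \<zeta> :: complex and \<rho> t :: real
  assumes holF: "F holomorphic_on ball 0 1" and holh: "h holomorphic_on ball 0 1"
    and F': "\<And>z. z \<in> ball 0 1 \<Longrightarrow> deriv F z = exp (h z)" and \<rho>: "\<rho> > 0"
  defines "z \<equiv> \<lambda>t. \<zeta> + of_real \<rho> * cis t"
  defines "\<theta> \<equiv> \<lambda>t. Im (h (z t)) + t + pi / 2"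
  defines "v \<equiv> \<lambda>t. of_real \<rho> * \<i> * cis t * exp (h (z t))"
  assumes t: "z t \<in> ball 0 1"
  shows "((\<lambda>t. F (z t)) has_vector_derivative v t) (at t)"
    and "v t \<noteq> 0" and "v t = of_real (norm (v t)) * cis (\<theta> t)"
    and "(\<theta> has_real_derivative Re (1 + (z t - \<zeta>) * deriv h (z t))) (at t)"
proof -
  have z': "(z has_vector_derivative of_real \<rho> * \<i> * cis t) (at t)"
  proof -
    have "(cis has_vector_derivative \<i> * cis t) (at t)"
      using has_derivative_cis[OF has_derivative_ident, of t UNIV] by (simp add: has_vector_derivative_def)
    from has_vector_derivative_add[OF has_vector_derivative_const has_vector_derivative_mult_right[OF this]]
    show ?thesis unfolding z_def mult.assoc by fastforce
  qed
  have chain: "((\<lambda>t. f (z t)) has_vector_derivative of_real \<rho> * \<i> * cis t * deriv f (z t)) (at t)"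
    if "f holomorphic_on ball 0 1" for f
    using field_vector_diff_chain_at[OF z' holomorphic_derivI[OF that open_ball t]] by (simp add: o_def)
  show "((\<lambda>t. F (z t)) has_vector_derivative v t) (at t)"
    using chain[OF holF] F'[OF t] by (simp add: v_def)
  show "v t \<noteq> 0" using \<rho> by (simp add: v_def)
  have "norm (v t) = \<rho> * exp (Re (h (z t)))"
    using \<rho> by (simp add: v_def norm_mult)
  moreover have "cis (\<theta> t) = cis (Im (h (z t))) * cis t * \<i>"
    by (simp add: \<theta>_def cis_mult[symmetric] cis_pi_half)
  ultimately show "v t = of_real (norm (v t)) * cis (\<theta> t)"
    by (simp add: v_def exp_eq_polar[of "h (z t)"] exp_of_real[symmetric] mult_ac)
  have "((\<lambda>t. Im (h (z t))) has_vector_derivative Im (of_real \<rho> * \<i> * cis t * deriv h (z t))) (at t)"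
    by (rule bounded_linear.has_vector_derivative[OF bounded_linear_Im chain[OF holh]])
  then have "((\<lambda>t. Im (h (z t))) has_real_derivative Im (of_real \<rho> * \<i> * cis t * deriv h (z t))) (at t)"
    by (simp add: has_real_derivative_iff_has_vector_derivative)
  then have "(\<theta> has_real_derivative Im (of_real \<rho> * \<i> * cis t * deriv h (z t)) + 1 + 0) (at t)"
    unfolding \<theta>_def by (intro DERIV_add DERIV_ident DERIV_const)
  moreover have "Im (of_real \<rho> * \<i> * cis t * deriv h (z t)) + 1 + 0 = Re (1 + (z t - \<zeta>) * deriv h (z t))"
    by (simp add: z_def algebra_simps)
  ultimately show "(\<theta> has_real_derivative Re (1 + (z t - \<zeta>) * deriv h (z t))) (at t)"
    by (simp only:)
qed

lemma cis_eq_imp_constant_difference: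
  fixes f g :: "real \<Rightarrow> real"
  assumes "continuous_on {a..b} f" "continuous_on {a..b} g"
    and "\<And>t. t \<in> {a..b} \<Longrightarrow> cis (f t) = cis (g t)" and st: "s \<in> {a..b}" "t \<in> {a..b}"
  shows "f s - g s = f t - g t"
proof -
  define N where "N = (\<lambda>t. (f t - g t) / (2 * pi))"
  have int: "N t \<in> \<int>" if t: "t \<in> {a..b}" for t
  proof -
    have "sin (f t) = sin (g t) \<and> cos (f t) = cos (g t)"
      using assms(3)[OF t] by (simp add: complex_eq_iff)
    then obtain n :: int where "f t = g t + 2 * pi * n"
      using sin_cos_eq_iff by metis
    then show ?thesis by (simp add: N_def)
  qed
  have "N constant_on {a..b}"
  proof (rule continuous_discrete_range_constant[OF connected_Icc])
    show "continuous_on {a..b} N"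
      unfolding N_def by (intro continuous_intros assms) simp
    fix x assume x: "x \<in> {a..b}"
    have "1 \<le> norm (N y - N x)" if y: "y \<in> {a..b}" "N y \<noteq> N x" for y
      using Ints_nonzero_abs_ge1[OF Ints_diff[OF int[OF y(1)] int[OF x]]] y(2) by simp
    then show "\<exists>e>0. \<forall>y. y \<in> {a..b} \<and> N y \<noteq> N x \<longrightarrow> e \<le> norm (N y - N x)"
      by (intro exI[of _ 1]) auto
  qed
  then have "N s = N t" using st by (auto simp: constant_on_def)
  then show ?thesis by (simp add: N_def)
qed

text \<open>
  The two-variable characterisation of uniform convexity. On a given arc, any continuous branch of the
  argument of the tangent differs from the smooth branch \<open>\<theta>\<close> by a constant, so it is nondecreasing if and
  only if \<open>\<theta>\<close> is. If the derivative \<open>\<kappa>\<close> of \<open>\<theta>\<close> is negative at some \<open>\<zeta>\<close> and \<open>z\<close>, then a short arc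
  about \<open>\<zeta>\<close> through \<open>z\<close> has a strictly decreasing argument.
\<close>
theorem class_UCV_iff:
  "F \<in> class_UCV \<longleftrightarrow> F \<in> class_S \<and>
     (\<forall>\<zeta>\<in>ball 0 1. \<forall>z\<in>ball 0 1. 0 \<le> Re (1 + (z - \<zeta>) * (deriv (deriv F) z / deriv F z)))"
proof (cases "F \<in> class_S")
  case True
  note S = class_S_D[OF True]
  obtain h where h: "h holomorphic_on ball 0 1" "\<And>z. z \<in> ball 0 1 \<Longrightarrow> deriv F z = exp (h z)"
    "\<And>z. z \<in> ball 0 1 \<Longrightarrow> deriv h z = deriv (deriv F) z / deriv F z"
    using disc_holomorphic_log[OF holomorphic_deriv[OF S(1) open_ball] S(5) S(3)] by metis
  define \<kappa> where "\<kappa> = (\<lambda>\<zeta> z. Re (1 + (z - \<zeta>) * deriv h z))"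
  define \<theta> where "\<theta> = (\<lambda>\<zeta> \<rho> t. Im (h (\<zeta> + complex_of_real \<rho> * cis t)) + t + pi / 2)"
  note arc = circular_arc_tangent[OF S(1) h(1,2)]
  have \<theta>': "(\<theta> \<zeta> \<rho> has_real_derivative \<kappa> \<zeta> (\<zeta> + of_real \<rho> * cis t)) (at t)"
    if "0 < \<rho>" "\<zeta> + of_real \<rho> * cis t \<in> ball 0 1" for \<zeta> \<rho> t
    unfolding \<theta>_def \<kappa>_def using arc(4)[OF _ that] by simp
  have "0 \<le> \<kappa> \<zeta> z" if U: "F \<in> class_UCV" and \<zeta>: "\<zeta> \<in> ball 0 1" and z: "z \<in> ball 0 1" for \<zeta> z
  proof (rule ccontr)
    assume "\<not> 0 \<le> \<kappa> \<zeta> z"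
    then have neg: "\<kappa> \<zeta> z < 0" and ne: "z \<noteq> \<zeta>" by (auto simp: \<kappa>_def)
    define \<rho> where "\<rho> = norm (z - \<zeta>)"
    have \<rho>: "\<rho> > 0" using ne by (simp add: \<rho>_def)
    define p where "p = (\<lambda>t. \<zeta> + complex_of_real \<rho> * cis t)"
    obtain t0 where t0: "p t0 = z"
      using rcis_cmod_Arg[of "z - \<zeta>"] by (metis add.commute diff_add_cancel p_def rcis_def \<rho>_def)
    define V where "V = {x \<in> ball 0 1. \<kappa> \<zeta> x < 0}"
    have "continuous_on (ball 0 1) (\<kappa> \<zeta>)"
      unfolding \<kappa>_def by (intro continuous_intros holomorphic_on_imp_continuous_on holomorphic_deriv h(1) open_ball)
    then have "open (ball 0 1 \<inter> \<kappa> \<zeta> -` {..<0})"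
      by (rule continuous_open_preimage) auto
    moreover have "ball 0 1 \<inter> \<kappa> \<zeta> -` {..<0} = V" by (auto simp: V_def)
    ultimately have "open V" by simp
    moreover have "continuous_on UNIV p" unfolding p_def by (intro continuous_intros)
    ultimately have "open (p -` V)" by (rule open_vimage)
    moreover have "t0 \<in> p -` V" using z neg by (simp add: t0 V_def)
    ultimately obtain e where e: "e > 0" "cball t0 e \<subseteq> p -` V"
      using open_contains_cball by blast
    (* An arc may not be longer than a full circle. *)
    define \<delta> where "\<delta> = min e pi"
    have \<delta>: "\<delta> > 0" "\<delta> \<le> pi" "\<delta> \<le> e" using e by (auto simp: \<delta>_def)
    define a where "a = t0 - \<delta>"
    define b where "b = t0 + \<delta>"
    have ab: "a < b" "b \<le> a + 2 * pi" using \<delta> by (auto simp: a_def b_def)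
    have "{a..b} \<subseteq> cball t0 e" using \<delta> by (auto simp: a_def b_def dist_real_def)
    then have pV: "p t \<in> V" if "t \<in> {a..b}" for t using that e by blast
    then have pin: "p t \<in> ball 0 1" if "t \<in> {a..b}" for t using that by (simp add: V_def)
    have "convex_arc (\<lambda>t. F (p t)) a b"
      using U \<zeta> \<rho> ab pin unfolding class_UCV_def p_def by blast
    then obtain \<phi> where \<phi>: "continuous_on {a..b} \<phi>" "mono_on {a..b} \<phi>"
      and v: "\<And>t. t \<in> {a..b} \<Longrightarrow> \<exists>v. ((\<lambda>t. F (p t)) has_vector_derivative v) (at t within {a..b}) \<and> v \<noteq> 0 \<and>
          v = of_real (norm v) * cis (\<phi> t)"
      unfolding convex_arc_def by blast
    have cis_eq: "cis (\<phi> t) = cis (\<theta> \<zeta> \<rho> t)" if t: "t \<in> {a..b}" for t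
    proof -
      define w where "w = of_real \<rho> * \<i> * cis t * exp (h (p t))"
      have w: "((\<lambda>t. F (p t)) has_vector_derivative w) (at t)" "w \<noteq> 0" 
        "w = of_real (norm w) * cis (\<theta> \<zeta> \<rho> t)"
        using arc(1-3)[OF _ \<rho>, of \<zeta> t] pin[OF t] unfolding w_def p_def \<theta>_def by blast+
      obtain v where v: "((\<lambda>t. F (p t)) has_vector_derivative v) (at t within {a..b})"
          "v = of_real (norm v) * cis (\<phi> t)"
        using v[OF t] by blast
      have "v = w"
        using vector_derivative_unique_within_closed_interval[OF ab(1), unfolded cbox_interval, OF t v(1)] 
          has_vector_derivative_at_within[OF w(1)] by blast
      then have "of_real (norm w) * cis (\<phi> t) = of_real (norm w) * cis (\<theta> \<zeta> \<rho> t)"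
        using v(2) w(3) by metis
      then show ?thesis using w(2) by simp
    qed
    have \<theta>'neg: "\<exists>y. (\<theta> \<zeta> \<rho> has_real_derivative y) (at t) \<and> y < 0" if "a \<le> t" "t \<le> b" for t
      using \<theta>'[OF \<rho>, of \<zeta> t] pV[of t] that by (auto simp: V_def p_def)
    have "continuous_on {a..b} (\<theta> \<zeta> \<rho>)"
      using \<theta>'neg by (meson DERIV_isCont atLeastAtMost_iff continuous_at_imp_continuous_on)
    then have "\<phi> a - \<theta> \<zeta> \<rho> a = \<phi> b - \<theta> \<zeta> \<rho> b"
      by (rule cis_eq_imp_constant_difference[OF \<phi>(1) _ cis_eq]) (use ab in auto)
    moreover have "\<theta> \<zeta> \<rho> b < \<theta> \<zeta> \<rho> a"
      by (rule DERIV_neg_imp_decreasing[OF ab(1)]) (use \<theta>'neg in blast)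
    moreover have "\<phi> a \<le> \<phi> b"
      using \<phi>(2) ab by (auto simp: mono_on_def)
    ultimately show False by simp
  qed
  moreover have "F \<in> class_UCV" if \<kappa>: "\<And>\<zeta> z. \<zeta> \<in> ball 0 1 \<Longrightarrow> z \<in> ball 0 1 \<Longrightarrow> 0 \<le> \<kappa> \<zeta> z"
  proof -
    have "convex_arc (\<lambda>t. F (\<zeta> + of_real \<rho> * cis t)) a b"
      if \<zeta>: "\<zeta> \<in> ball 0 1" and \<rho>: "0 < \<rho>" and sub: "(\<lambda>t. \<zeta> + of_real \<rho> * cis t) ` {a..b} \<subseteq> ball 0 1" for \<zeta> \<rho> a b
    proof -
      have pin: "\<zeta> + of_real \<rho> * cis t \<in> ball 0 1" if "t \<in> {a..b}" for t
        using sub that by blast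
      have \<theta>'pos: "\<exists>y. (\<theta> \<zeta> \<rho> has_real_derivative y) (at t) \<and> 0 \<le> y" if "t \<in> {a..b}" for t
        using \<theta>'[OF \<rho> pin[OF that]] \<kappa>[OF \<zeta> pin[OF that]] by blast
      have "mono_on {a..b} (\<theta> \<zeta> \<rho>)"
      proof (rule mono_onI)
        fix r s assume rs: "r \<in> {a..b}" "s \<in> {a..b}" "r \<le> s"
        show "\<theta> \<zeta> \<rho> r \<le> \<theta> \<zeta> \<rho> s"
          by (rule DERIV_nonneg_imp_nondecreasing[OF rs(3)], rule \<theta>'pos) (use rs in auto)
      qed
      moreover have "continuous_on {a..b} (\<theta> \<zeta> \<rho>)"
        using \<theta>'pos by (meson DERIV_isCont continuous_at_imp_continuous_on)
      moreover have "\<exists>v. ((\<lambda>t. F (\<zeta> + of_real \<rho> * cis t)) has_vector_derivative v) (at t within {a..b}) \<and> v \<noteq> 0 \<and>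
          v = of_real (norm v) * cis (\<theta> \<zeta> \<rho> t)" if t: "t \<in> {a..b}" for t
      proof -
        define v where "v = of_real \<rho> * \<i> * cis t * exp (h (\<zeta> + of_real \<rho> * cis t))"
        have "((\<lambda>t. F (\<zeta> + of_real \<rho> * cis t)) has_vector_derivative v) (at t)" "v \<noteq> 0" 
          "v = of_real (norm v) * cis (\<theta> \<zeta> \<rho> t)"
          using arc(1-3)[OF _ \<rho> pin[OF t]] unfolding v_def \<theta>_def by blast+
        then show ?thesis using has_vector_derivative_at_within by blast
      qed
      ultimately show ?thesis unfolding convex_arc_def by blast
    qed
    then show ?thesis using True by (auto simp: class_UCV_def)
  qed
  ultimately have "F \<in> class_UCV \<longleftrightarrow> (\<forall>\<zeta>\<in>ball 0 1. \<forall>z\<in>ball 0 1. 0 \<le> \<kappa> \<zeta> z)" by blast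
  also have "\<dots> \<longleftrightarrow> (\<forall>\<zeta>\<in>ball 0 1. \<forall>z\<in>ball 0 1. 0 \<le> Re (1 + (z - \<zeta>) * (deriv (deriv F) z / deriv F z)))"
    unfolding \<kappa>_def by (intro ball_cong refl) (simp only: h(3))
  finally show ?thesis using True by blast
qed (simp add: class_UCV_def)

text \<open>
  The largest disc about \<open>1 + c\<close> inside the parabolic region \<open>\<bar>x - 1\<bar> \<le> Re x\<close> touches the boundary
  at the vertex \<open>1/2\<close>, provided that \<open>c \<le> 1/2\<close>. In terms of the distance \<open>s\<close> of \<open>1 + q\<close> from the line
  \<open>Re x = 1/2\<close>, the claim reduces to \<open>s\<^sup>2 + s (1 - 2 c) \<ge> 0\<close>.
\<close>
lemma disc_in_parabola:
  fixes q :: complex and c :: real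
  assumes q: "norm (q - of_real c) \<le> c + 1/2" and c: "0 \<le> c" "c \<le> 1/2"
  shows "norm q \<le> Re (1 + q)"
proof -
  define s where "s = Re q + 1/2"
  have "c - Re q \<le> c + 1/2"
    using order_trans[OF abs_Re_le_cmod q] by (simp add: abs_le_iff)
  then have s: "s \<ge> 0" by (simp add: s_def)
  have "(norm (q - of_real c))\<^sup>2 \<le> (c + 1/2)\<^sup>2"
    using q by (intro power_mono) auto
  then have *: "(Re q - c)\<^sup>2 + (Im q)\<^sup>2 \<le> (c + 1/2)\<^sup>2" by (simp add: cmod_power2)
  have "0 \<le> s\<^sup>2 + s * (1 - 2 * c)" using s c by simp
  with * have "(norm q)\<^sup>2 \<le> (1 + Re q)\<^sup>2"
    unfolding cmod_power2 by (simp add: s_def power2_eq_square algebra_simps)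
  then show ?thesis
    using s by (simp add: s_def abs_le_square_iff[symmetric])
qed

text \<open>
  For \<open>\<bar>\<zeta>\<bar> \<le> \<bar>z\<bar>\<close> the bound is immediate, because \<open>\<bar>\<zeta> p z\<bar> \<le> \<bar>z p z\<bar>\<close>. In particular it holds on the
  circle \<open>\<bar>z\<bar> = \<bar>\<zeta>\<bar>\<close>, and the maximum principle for \<open>exp (- (1 + (z - \<zeta>) p z))\<close> carries it into the
  interior of that circle.
\<close>
lemma two_variable_bound_if_parabolic:
  assumes holp: "p holomorphic_on ball 0 1" and par: "\<And>z. z \<in> ball 0 1 \<Longrightarrow> norm (z * p z) \<le> Re (1 + z * p z)"
    and \<zeta>: "\<zeta> \<in> ball 0 1" and z: "z \<in> ball 0 1"
  shows "0 \<le> Re (1 + (z - \<zeta>) * p z)"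
proof -
  have direct: "0 \<le> Re (1 + (x - \<zeta>) * p x)" if x: "x \<in> ball 0 1" "norm \<zeta> \<le> norm x" for x
  proof -
    have "Re (\<zeta> * p x) \<le> norm (\<zeta> * p x)" by (rule complex_Re_le_cmod)
    also have "\<dots> \<le> norm (x * p x)" using x by (simp add: norm_mult mult_right_mono)
    also have "\<dots> \<le> Re (1 + x * p x)" by (rule par[OF x(1)])
    finally show ?thesis by (simp add: left_diff_distrib)
  qed
  show ?thesis
  proof (cases "norm \<zeta> \<le> norm z")
    case False
    define E where "E = (\<lambda>x. exp (- (1 + (x - \<zeta>) * p x)))"
    have sub: "cball 0 (norm \<zeta>) \<subseteq> ball (0::complex) 1" using \<zeta> by auto
    have holE: "E holomorphic_on cball 0 (norm \<zeta>)"
      unfolding E_def by (intro holomorphic_intros holomorphic_on_subset[OF holp sub])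
    have "norm (E z) \<le> 1"
    proof (rule maximum_modulus_frontier[of E "cball 0 (norm \<zeta>)"])
      show "E holomorphic_on interior (cball 0 (norm \<zeta>))"
        by (rule holomorphic_on_subset[OF holE interior_subset])
      show "continuous_on (closure (cball 0 (norm \<zeta>))) E"
        using holE by (simp add: holomorphic_on_imp_continuous_on)
      show "norm (E x) \<le> 1" if "x \<in> frontier (cball 0 (norm \<zeta>))" for x
      proof -
        have "norm x = norm \<zeta>" using that by (simp add: frontier_cball split: if_splits)
        then show ?thesis using direct[of x] \<zeta> by (simp add: E_def)
      qed
    qed (use False in auto)
    then show ?thesis by (simp add: E_def)
  qed (use direct z in blast)
qed

theorem class_UCV_radius_of_class_F6:
  "is_radius class_UCV class_F6 (5 - 2 * sqrt 6)"
proof -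
  define R where "R = 5 - 2 * sqrt (6::real)"
  have quad: "0 < R" "R \<le> 1/5" 
      "\<And>u. 0 \<le> u \<Longrightarrow> u < 1 \<Longrightarrow> 1/2 < (1 - 5 * u) / (1 - u\<^sup>2) \<longleftrightarrow> u < R"
      "\<And>u. 0 \<le> u \<Longrightarrow> u < 1 \<Longrightarrow> 1/2 \<le> (1 - 5 * u) / (1 - u\<^sup>2) \<longleftrightarrow> u \<le> R"
    using convexity_radius_quadratic[of "1/2"] unfolding convexity_radius_half R_def[symmetric] by auto
  have "radius_property class_UCV class_F6 R"
    unfolding radius_property_def
  proof (intro conjI allI impI)
    fix r f assume "0 < r \<and> r \<le> R \<and> f \<in> class_F6"
    then have r: "0 < r" "r \<le> R" "r \<le> 1/5" and f: "f \<in> class_F6"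
      using quad(2) by auto
    have holf: "f holomorphic_on ball 0 1" using f by (simp add: class_F6_def class_A_def)
    define F where "F = (\<lambda>z. f (of_real r * z) / of_real r)"
    have F: "F \<in> class_S" using class_F6_dilation_univalent[OF f r(1,3)] by (simp add: F_def)
    define p where "p = (\<lambda>z. deriv (deriv F) z / deriv F z)"
    have holp: "p holomorphic_on ball 0 1"
      unfolding p_def using class_S_D[OF F] by (intro holomorphic_intros holomorphic_deriv) auto
    have par: "norm (z * p z) \<le> Re (1 + z * p z)" if z: "z \<in> ball 0 1" for z
    proof -
      define x where "x = of_real r * z"
      define u where "u = norm x"
      have "r * norm z < r * 1" using r z by (intro mult_strict_left_mono) auto
      then have "u < r" using r(1) by (simp add: u_def x_def norm_mult)
      then have u: "0 \<le> u" "u < R" "u < 1" "u < 1/5" using r by (simp_all add: u_def)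
      have "u\<^sup>2 \<le> (1/5)\<^sup>2" using u by (intro power_mono) auto
      then have u2: "u\<^sup>2 \<le> 1/25" by (simp add: power2_eq_square)
      define d where "d = 1 - u\<^sup>2"
      have d: "d \<ge> 24/25" using u2 by (simp add: d_def)
      have zp: "z * p z = x * deriv (deriv f) x / deriv f x"
        unfolding F_def x_def p_def times_divide_eq_right
        using disc_dilation_pre_schwarzian[OF holf _ _ z, of "of_real r"] r by simp
      have "norm (z * p z - of_real (2 * u\<^sup>2 / d)) \<le> (5 * u + u\<^sup>2) / d"
        using class_F6_convexity_disc(1)[OF f, of x] u by (simp add: zp u_def d_def)
      also have "\<dots> \<le> 2 * u\<^sup>2 / d + 1/2"
      proof -
        have "(1 - 5 * u) / d > 1/2" using quad(3)[of u] u by (simp add: d_def)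
        then have "5 * u + u\<^sup>2 \<le> 2 * u\<^sup>2 + d / 2" using d by (simp add: field_simps d_def)
        then have "(5 * u + u\<^sup>2) / d \<le> (2 * u\<^sup>2 + d / 2) / d" using d by (intro divide_right_mono) auto
        also have "\<dots> = 2 * u\<^sup>2 / d + 1/2" using d by (simp add: add_divide_distrib)
        finally show ?thesis .
      qed
      finally show ?thesis
        by (rule disc_in_parabola) (use d u2 in \<open>auto simp: divide_le_eq\<close>)
    qed
    show "(\<lambda>z. f (of_real r * z) / of_real r) \<in> class_UCV"
      using two_variable_bound_if_parabolic[OF holp par] F
      unfolding class_UCV_iff F_def[symmetric] p_def by blast
  qed (use quad in auto)
  moreover have "R' \<le> R" if R': "radius_property class_UCV class_F6 R'" for R'
  proof (rule ccontr)
    assume "\<not> R' \<le> R"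
    then have r: "R < R'" "R' \<le> 1" "0 < R'" using R' quad(1) by (auto simp: radius_property_def)
    obtain u where u: "R < u" "u < R'" using dense[OF r(1)] by blast
    then have u1: "0 < u" "u < 1" using r quad(1) by auto
    obtain f z where f: "f \<in> class_F6" and z: "z \<in> ball 0 1"
      and ext: "z * deriv (deriv (\<lambda>z. f (of_real R' * z) / of_real R')) z / deriv (\<lambda>z. f (of_real R' * z) / of_real R') z =
         complex_of_real ((u\<^sup>2 - 5 * u) / (1 - u\<^sup>2))"
      using class_F6_extremal_dilation[OF u1(1) u(2) r(2)] by blast
    define F where "F = (\<lambda>z. f (of_real R' * z) / of_real R')"
    have "F \<in> class_UCV"
      using R' f r by (simp add: radius_property_def F_def)
    moreover have "- z \<in> ball 0 1" using z by simp
    (* The antipodal centre -z doubles the pre-Schwarzian term. *)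
    ultimately have 1: "0 \<le> Re (1 + (z - - z) * (deriv (deriv F) z / deriv F z))"
      using z unfolding class_UCV_iff by blast
    have "z * deriv (deriv F) z / deriv F z = of_real ((u\<^sup>2 - 5 * u) / (1 - u\<^sup>2))"
      using ext by (simp only: F_def)
    moreover have "(z - - z) * q = 2 * (z * q)" for q by simp
    ultimately have "(z - - z) * (deriv (deriv F) z / deriv F z) = of_real (2 * ((u\<^sup>2 - 5 * u) / (1 - u\<^sup>2)))"
      by (metis of_real_mult of_real_numeral times_divide_eq_right)
    with 1 have "0 \<le> 1 + 2 * ((u\<^sup>2 - 5 * u) / (1 - u\<^sup>2))"
      by (simp only: plus_complex.sel one_complex.sel Re_complex_of_real)
    moreover have d: "1 - u\<^sup>2 > 0" using u1 by (simp add: power_less_one_iff)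
    ultimately have "(1 - 5 * u) / (1 - u\<^sup>2) \<ge> 1/2"
      by (simp add: field_simps)
    then show False
      using quad(4)[of u] u u1 by simp
  qed
  ultimately show ?thesis by (simp add: is_radius_def R_def)
qed

theorem theorem3p1:
  shows "(\<forall>\<alpha>::real. 0 \<le> \<alpha> \<and> \<alpha> < 1 \<longrightarrow>
            is_radius (class_C \<alpha>) class_F6
              (2 * (1 - \<alpha>) / (5 + sqrt (25 + 4 * \<alpha> * (\<alpha> - 1))))) \<and>
         is_radius class_UCV class_F6 (5 - 2 * sqrt 6) \<and>
         is_radius (class_C (1/2)) class_F6 (5 - 2 * sqrt 6)"
  using class_C_radius_of_class_F6 class_UCV_radius_of_class_F6
    class_C_radius_of_class_F6[of "1/2"] unfolding convexity_radius_half by auto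

end
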